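(* Assume (H1)–(H4) and (U) (for given $x_0$, $r$, $\theta$). Let $u\in C(\mathbb{R}^n\times[0,T))$ be a viscosity solution of (1.1)–(1.2). Then: (i) if $(C_1,K_3)\ne(0,0)$, $|p|\ge\theta e^{-(C_1+K_3)t}-\frac{C_1\beta}{C_1+K_3}(1-e^{-(C_1+K_3)t})$ for all $(x,t)\in\mathcal{E}(x_0,r)$ and $p\in D_x^-u(x,t)$; (ii) if $(C_1,K_3)=(0,0)$, $|p|\ge\theta$ for all $(x,t)\in\mathcal{E}(x_0,r)$ and $p\in D_x^-u(x,t)$.
   Context: Let $T>0$, $n\ge1$. $H:\mathbb{R}^n\times[0,T]\times\mathbb{R}\times\mathbb{R}^n\to\mathbb{R}$ continuous, $u_0$ Lipschitz. Problem (1.1)–(1.2): $u_t+H(x,t,u,D_xu)=0$ in $\mathbb{R}^n\times(0,T)$, $u(x,0)=u_0(x)$. (H1) there exist $C_1\ge0$, $\beta\in\{0,1\}$ with $|H(x,t,u,p)-H(y,t,u,p)|\le C_1(\beta+|p|)|x-y|$. (H2) there exist $A_2,B_2\ge0$ with $|H(x,t,u,p)-H(x,t,u,q)|\le(A_2|x|+B_2)|p-q|$. (H3) there exists $K_3\ge0$ with $|H(x,t,u,p)-H(x,t,v,p)|\le K_3|u-v|$. (H4) $p\mapsto H(x,t,u,p)$ convex. (U) for the given $x_0$, $r>0$ there is $\theta>0$ with $|p|\ge\theta$ for all $x\in B_r(x_0)$, $p\in D^-u_0(x)$. Viscosity solution: $u\in C(\mathbb{R}^n\times[0,T))$, $u(\cdot,0)=u_0$,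 and for every $\phi\in C^1(\mathbb{R}^n\times(0,T))$, if $u-\phi$ has a local max (resp. min) at $(x,t)\in\mathbb{R}^n\times(0,T)$ then $\phi_t+H(x,t,u(x,t),D_x\phi(x,t))\le0$ (resp. $\ge0$). $D^-f(x)=\{D\phi(x):\phi\in C^1,\ f-\phi$ has a local min at $x\}$; $D_x^-u(x,t)=\{p:(p,\tau)\in D^-u(x,t)\}$. $R(x,t)=(\frac{B_2}{A_2}+|x|)(e^{A_2t}-1)$ if $A_2>0$, $=B_2t$ if $A_2=0$; $\mathcal{E}(x_0,r)=\{(x,t)\in B_r(x_0)\times(0,T):R(x,t)+|x-x_0|<r\}$. *)

theory Defs
  imports "HOL-Analysis.Analysis"
begin

definition C1_on :: "'a::euclidean_space set \<Rightarrow> ('a \<Rightarrow> real) \<Rightarrow> ('a \<Rightarrow> 'a) \<Rightarrow> bool" where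
  "C1_on S \<phi> g \<longleftrightarrow> (\<forall>z\<in>S. (\<phi> has_derivative (\<lambda>h. g z \<bullet> h)) (at z)) \<and> continuous_on S g"

definition subdiff :: "'a::euclidean_space set \<Rightarrow> ('a \<Rightarrow> real) \<Rightarrow> 'a \<Rightarrow> 'a set" where
  "subdiff S f z = {g z | \<phi> g. C1_on S \<phi> g \<and>
      (\<exists>e>0. \<forall>y\<in>S. dist y z < e \<longrightarrow> f z - \<phi> z \<le> f y - \<phi> y)}"

definition subdiff_x :: "real \<Rightarrow> (real^'n::finite \<Rightarrow> real \<Rightarrow> real) \<Rightarrow> real^'n \<Rightarrow> real \<Rightarrow> (real^'n) set" where
  "subdiff_x T u x t = {p. \<exists>\<tau>. (p, \<tau>) \<in> subdiff (UNIV \<times> {0<..<T}) (\<lambda>(y, s). u y s) (x, t)}"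

definition visc_solution ::
  "real \<Rightarrow> (real^'n \<Rightarrow> real \<Rightarrow> real \<Rightarrow> real^'n \<Rightarrow> real) \<Rightarrow> (real^'n \<Rightarrow> real)
     \<Rightarrow> (real^'n \<Rightarrow> real \<Rightarrow> real) \<Rightarrow> bool" where
  "visc_solution T H u0 u \<longleftrightarrow>
     continuous_on (UNIV \<times> {0..<T}) (\<lambda>(x, t). u x t) \<and>
     (\<forall>x. u x 0 = u0 x) \<and>
     (\<forall>\<phi> g x t. C1_on (UNIV \<times> {0<..<T}) \<phi> g \<and> 0 < t \<and> t < T \<longrightarrow>
        ((\<exists>e>0. \<forall>y s. 0 < s \<and> s < T \<and> dist (y, s) (x, t) < e \<longrightarrow>
             u y s - \<phi> (y, s) \<le> u x t - \<phi> (x, t))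
           \<longrightarrow> snd (g (x, t)) + H x t (u x t) (fst (g (x, t))) \<le> 0) \<and>
        ((\<exists>e>0. \<forall>y s. 0 < s \<and> s < T \<and> dist (y, s) (x, t) < e \<longrightarrow>
             u x t - \<phi> (x, t) \<le> u y s - \<phi> (y, s))
           \<longrightarrow> snd (g (x, t)) + H x t (u x t) (fst (g (x, t))) \<ge> 0))"

definition Rfun :: "real \<Rightarrow> real \<Rightarrow> real^'n \<Rightarrow> real \<Rightarrow> real" where
  "Rfun A2 B2 x t = (if A2 > 0 then (B2 / A2 + norm x) * (exp (A2 * t) - 1) else B2 * t)"

definition Eset :: "real \<Rightarrow> real \<Rightarrow> real \<Rightarrow> real^'n \<Rightarrow> real \<Rightarrow> ((real^'n) \<times> real) set" where
  "Eset T A2 B2 x0 r = {(x, t). x \<in> ball x0 r \<and> 0 < t \<and> t < T \<and> Rfun A2 B2 x t + dist x x0 < r}"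

end

theory Submission
  imports Defs
begin

text \<open>
  A lower bound \<open>\<theta>\<close> on the norms of the subgradients of a function means that the function drops by
  at least \<open>\<theta> * r\<close> within every small ball of radius \<open>r\<close>. To propagate this property of the initial
  datum, put \<open>M x t = ball_min (\<lambda>y. u y t) (\<rho> t) x + m t\<close>, where \<open>\<rho>\<close> grows slightly faster than at
  rate \<open>C\<close> and \<open>m' = - K * m - C * \<beta> * \<rho>\<close>. Convexity of \<open>H\<close> makes \<open>M\<close> a viscosity subsolution,
  \<open>M \<le> u\<close> holds initially near \<open>x0\<close>, and comparison in the dependence cone preserves it. Hence \<open>u\<close>
  drops by \<open>m t\<close> within the ball of radius \<open>\<rho> t\<close>, which forces \<open>m t / \<rho> t \<le> norm p\<close>.
\<close>

subsection \<open>Affine minorants of convex functions\<close>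

lemma convex_strict_epigraph:
  fixes F :: "'a::real_vector \<Rightarrow> real"
  assumes "convex_on UNIV F"
  shows "convex {(q, z). F q < z}"
proof (rule convexI, clarsimp)
  fix x y :: 'a and s t u v :: real
  assume less: "F x < s" "F y < t" and weights: "0 \<le> u" "0 \<le> v" "u + v = 1"
  have "F (u *\<^sub>R x + v *\<^sub>R y) \<le> u * F x + v * F y"
    using assms weights by (auto simp: convex_on_def)
  also have "\<dots> < u * s + v * t"
  proof (cases "u = 0")
    case False
    then show ?thesis
      using less weights by (intro add_less_le_mono mult_strict_left_mono mult_left_mono) auto
  qed (use less weights in auto)
  finally show "F (u *\<^sub>R x + v *\<^sub>R y) < u * s + v * t" .
qed

lemma separating_slope_pos:
  fixes F :: "'a::real_inner \<Rightarrow> real"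
  assumes nonzero: "(v, k) \<noteq> 0" and above: "\<And>q z. F q < z \<Longrightarrow> d \<le> v \<bullet> q + k * z"
    and below: "v \<bullet> q0 + k * s0 \<le> d"
  shows "0 < k"
proof -
  have "0 \<le> k"
  proof (rule ccontr)
    assume "\<not> 0 \<le> k"
    define z where "z = max (F 0 + 1) (d / k + 1)"
    have "k * z \<le> k * (d / k + 1)" using \<open>\<not> 0 \<le> k\<close> by (intro mult_left_mono_neg) (auto simp: z_def)
    also have "\<dots> < d" using \<open>\<not> 0 \<le> k\<close> by (simp add: distrib_left)
    finally have "k * z < d" .
    moreover have "F 0 < z" by (simp add: z_def)
    ultimately show False using above[of 0 z] by simp
  qed
  moreover have "k \<noteq> 0"
  proof
    assume "k = 0"
    then have "v \<bullet> v \<le> 0" using below above[of "q0 - v" "F (q0 - v) + 1"] by (simp add: inner_diff_right)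
    then have "v = 0" by (metis inner_eq_zero_iff inner_ge_zero order_antisym)
    then show False using nonzero \<open>k = 0\<close> by (simp add: zero_prod_def)
  qed
  ultimately show ?thesis by simp
qed

lemma convex_affine_separation:
  fixes F :: "'a::euclidean_space \<Rightarrow> real"
  assumes F: "convex_on UNIV F" and S: "convex S" "S \<noteq> {}"
    and below: "\<And>q s. (q, s) \<in> S \<Longrightarrow> s \<le> F q"
  obtains a c where "\<And>q. a \<bullet> q + c \<le> F q" "\<And>q s. (q, s) \<in> S \<Longrightarrow> s \<le> a \<bullet> q + c"
proof -
  have "{(q, z). F q < z} \<noteq> {}" by (auto intro: lt_ex gt_ex)
  moreover have "S \<inter> {(q, z). F q < z} = {}" using below by fastforce
  ultimately obtain vk d where sep: "vk \<noteq> 0" "\<forall>x\<in>S. vk \<bullet> x \<le> d" "\<forall>x\<in>{(q, z). F q < z}. d \<le> vk \<bullet> x"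
    using separating_hyperplane_sets[OF S(1) convex_strict_epigraph[OF F] S(2)] by metis
  obtain v k where vk: "vk = (v, k)" by (cases vk)
  have on_S: "v \<bullet> q + k * s \<le> d" if "(q, s) \<in> S" for q s
    using sep(2) that by (auto simp: vk)
  have above: "d \<le> v \<bullet> q + k * z" if "F q < z" for q z
    using sep(3) that by (auto simp: vk)
  obtain q0 s0 where "(q0, s0) \<in> S" using S(2) by auto
  have k: "0 < k"
    by (rule separating_slope_pos[OF _ above on_S[OF \<open>(q0, s0) \<in> S\<close>]]) (use sep(1) vk in simp)
  have affine: "(- (1 / k) *\<^sub>R v) \<bullet> q + d / k = (d - v \<bullet> q) / k" for q
    by (simp add: diff_divide_distrib)
  show thesis
  proof (rule that[of "- (1 / k) *\<^sub>R v" "d / k"]; unfold affine)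
    show "(d - v \<bullet> q) / k \<le> F q" for q
    proof (rule dense_ge)
      show "(d - v \<bullet> q) / k \<le> z" if "F q < z" for z
        using above[OF that] k by (simp add: divide_le_eq mult.commute)
    qed
    show "s \<le> (d - v \<bullet> q) / k" if "(q, s) \<in> S" for q s
      using on_S[OF that] k by (simp add: le_divide_eq mult.commute)
  qed
qed

lemma convex_subgradient:
  fixes F :: "'a::euclidean_space \<Rightarrow> real"
  assumes "convex_on UNIV F"
  obtains a where "\<And>q. F p + a \<bullet> (q - p) \<le> F q"
proof -
  obtain a c where below: "\<And>q. a \<bullet> q + c \<le> F q" and touch: "\<And>q s. (q, s) \<in> {(p, F p)} \<Longrightarrow> s \<le> a \<bullet> q + c"
    using convex_affine_separation[OF assms, of "{(p, F p)}"] by auto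
  have "F p + a \<bullet> (q - p) \<le> F q" for q
    using below[of p] below[of q] touch[of p "F p"] by (simp add: inner_diff_right)
  then show thesis by (rule that)
qed

lemma convex_hypograph_cone:
  fixes a :: "'a::real_inner"
  assumes "K \<ge> 0"
  shows "convex {(q, s). s \<le> c + a \<bullet> q - K * norm q}"
proof (rule convexI, clarsimp)
  fix x y :: 'a and s t u v :: real
  assume s: "s \<le> c + a \<bullet> x - K * norm x" and t: "t \<le> c + a \<bullet> y - K * norm y"
    and weights: "0 \<le> u" "0 \<le> v" "u + v = 1"
  have "norm (u *\<^sub>R x + v *\<^sub>R y) \<le> u * norm x + v * norm y"
    using norm_triangle_ineq[of "u *\<^sub>R x" "v *\<^sub>R y"] weights by simp
  then have "K * norm (u *\<^sub>R x + v *\<^sub>R y) \<le> K * (u * norm x + v * norm y)"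
    using assms by (rule mult_left_mono)
  moreover have "u * s + v * t \<le> u * (c + a \<bullet> x - K * norm x) + v * (c + a \<bullet> y - K * norm y)"
    using weights by (intro add_mono mult_left_mono s t)
  moreover have "u * c + v * c = c" using weights by (metis distrib_right mult_1)
  ultimately show "u * s + v * t \<le> c + a \<bullet> (u *\<^sub>R x + v *\<^sub>R y) - K * norm (u *\<^sub>R x + v *\<^sub>R y)"
    by (simp add: algebra_simps inner_add_right)
qed

lemma convex_affine_minorant_above_cone:
  fixes F :: "'a::euclidean_space \<Rightarrow> real"
  assumes F: "convex_on UNIV F" and "K \<ge> 0" and cone: "\<And>q. c + a \<bullet> q - K * norm q \<le> F q"
  obtains b where "norm (b - a) \<le> K" "\<And>q. c + b \<bullet> q \<le> F q"
proof -
  obtain b d where below: "\<And>q. b \<bullet> q + d \<le> F q"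
    and above: "\<And>q s. (q, s) \<in> {(q, s). s \<le> c + a \<bullet> q - K * norm q} \<Longrightarrow> s \<le> b \<bullet> q + d"
  proof (rule convex_affine_separation[OF F convex_hypograph_cone[OF \<open>K \<ge> 0\<close>, of c a]])
    show "{(q, s). s \<le> c + a \<bullet> q - K * norm q} \<noteq> {}" by (auto intro: order_refl)
    show "s \<le> F q" if "(q, s) \<in> {(q, s). s \<le> c + a \<bullet> q - K * norm q}" for q s
      using that cone[of q] by auto
  qed blast
  have cone_le: "c + a \<bullet> q - K * norm q \<le> b \<bullet> q + d" for q using above by auto
  have "c \<le> d" using cone_le[of 0] by simp
  have "norm (b - a) \<le> K"
  proof (rule ccontr)
    assume "\<not> norm (b - a) \<le> K"
    define w where "w = b - a"
    define s where "s = (d - c + 1) / (norm w * (norm w - K))"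
    have pos: "norm w * (norm w - K) > 0"
      using \<open>\<not> norm (b - a) \<le> K\<close> \<open>K \<ge> 0\<close> by (intro mult_pos_pos) (auto simp: w_def)
    then have "s \<ge> 0" using \<open>c \<le> d\<close> by (simp add: s_def)
    have "s * (norm w * (norm w - K)) = d - c + 1"
      using pos unfolding s_def by (metis nonzero_divide_eq_eq less_irrefl)
    then have "- (s * (norm w * (norm w - K))) = c - d - 1" by simp
    moreover have "c - d \<le> w \<bullet> (- s *\<^sub>R w) + K * norm (- s *\<^sub>R w)"
      using cone_le[of "- s *\<^sub>R w"] by (simp add: w_def inner_diff_left right_diff_distrib)
    moreover have "w \<bullet> (- s *\<^sub>R w) + K * norm (- s *\<^sub>R w) = - (s * (norm w * (norm w - K)))"
      using \<open>s \<ge> 0\<close> by (simp add: dot_square_norm power2_eq_square algebra_simps)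
    ultimately show False by simp
  qed
  moreover have "c + b \<bullet> q \<le> F q" for q using below[of q] \<open>c \<le> d\<close> by simp
  ultimately show thesis by (rule that)
qed

subsection \<open>Continuously differentiable functions\<close>

lemma C1_on_subset: "C1_on S f f' \<Longrightarrow> S' \<subseteq> S \<Longrightarrow> C1_on S' f f'"
  unfolding C1_on_def by (auto intro: continuous_on_subset)

lemma C1_on_imp_continuous_on: "C1_on S f f' \<Longrightarrow> continuous_on S f"
  unfolding C1_on_def by (meson continuous_at_imp_continuous_on has_derivative_continuous)

lemma C1_on_imp_continuous_on_gradient: "C1_on S f f' \<Longrightarrow> continuous_on S f'"
  unfolding C1_on_def by blast

lemma C1_on_add:
  "C1_on S f f' \<Longrightarrow> C1_on S g g' \<Longrightarrow> C1_on S (\<lambda>z. f z + g z) (\<lambda>z. f' z + g' z)"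
  unfolding C1_on_def by (auto intro!: continuous_intros derivative_eq_intros simp: inner_add_left)

lemma C1_on_add_const: "C1_on S f f' \<Longrightarrow> C1_on S (\<lambda>z. f z + c) f'"
  unfolding C1_on_def by (auto intro!: derivative_eq_intros)

lemma C1_on_cmult: "C1_on S f f' \<Longrightarrow> C1_on S (\<lambda>z. c * f z) (\<lambda>z. c *\<^sub>R f' z)"
  unfolding C1_on_def by (auto intro!: continuous_intros derivative_eq_intros)

lemma C1_on_uminus: "C1_on S f f' \<Longrightarrow> C1_on S (\<lambda>z. - f z) (\<lambda>z. - f' z)"
  using C1_on_cmult[of S f f' "-1"] by simp

lemma C1_on_mult:
  "C1_on S f f' \<Longrightarrow> C1_on S g g' \<Longrightarrow> C1_on S (\<lambda>z. f z * g z) (\<lambda>z. f z *\<^sub>R g' z + g z *\<^sub>R f' z)"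
  using C1_on_imp_continuous_on[of S f f'] C1_on_imp_continuous_on[of S g g']
  unfolding C1_on_def
  by (auto intro!: continuous_intros derivative_eq_intros simp: inner_add_left algebra_simps)

lemma C1_on_real:
  assumes "\<And>r. (k has_real_derivative k' r) (at r)" "continuous_on UNIV k'"
  shows "C1_on UNIV k k'"
  using assms unfolding C1_on_def has_field_derivative_def by simp

lemma C1_on_compose_affine:
  fixes A :: "'b::euclidean_space \<Rightarrow> 'a::euclidean_space"
  assumes f: "C1_on UNIV f f'" and A: "bounded_linear A"
    and adjoint: "bounded_linear A'" "\<And>x h. A' x \<bullet> h = x \<bullet> A h"
  shows "C1_on S (\<lambda>z. f (A z + c)) (\<lambda>z. A' (f' (A z + c)))"
  unfolding C1_on_def
proof (intro conjI ballI)
  fix z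
  have "((\<lambda>z. A z + c) has_derivative A) (at z)"
    using has_derivative_add_const[OF bounded_linear_imp_has_derivative[OF A]] by simp
  moreover have "(f has_derivative (\<lambda>h. f' (A z + c) \<bullet> h)) (at (A z + c))"
    using f by (simp add: C1_on_def)
  ultimately show "((\<lambda>z. f (A z + c)) has_derivative (\<lambda>h. A' (f' (A z + c)) \<bullet> h)) (at z)"
    using has_derivative_compose[of "\<lambda>z. A z + c" A z UNIV f] by (simp add: adjoint(2))
next
  have "continuous_on S (\<lambda>z. A z + c)"
    by (intro continuous_intros linear_continuous_on A)
  then have "continuous_on S (\<lambda>z. f' (A z + c))"
    using continuous_on_compose2[of UNIV f'] f by (auto simp: C1_on_def)
  then show "continuous_on S (\<lambda>z. A' (f' (A z + c)))"
    by (rule bounded_linear.continuous_on[OF adjoint(1)])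
qed

lemma C1_on_compose_snd:
  assumes "C1_on UNIV k k'"
  shows "C1_on S (\<lambda>z::'a::euclidean_space \<times> real. k (snd z)) (\<lambda>z. (0, k' (snd z)))"
  using C1_on_compose_affine[OF assms bounded_linear_snd
      bounded_linear_Pair[OF bounded_linear_zero bounded_linear_ident],
      where c = 0 and S = S] by (simp add: inner_prod_def)

lemma C1_on_point_reflection:
  fixes f :: "'a::euclidean_space \<Rightarrow> real"
  assumes "C1_on UNIV f f'"
  shows "C1_on S (\<lambda>x. - f (- x)) (\<lambda>x. f' (- x))"
  using C1_on_uminus[OF C1_on_compose_affine[OF assms bounded_linear_minus[OF bounded_linear_ident]
        bounded_linear_minus[OF bounded_linear_ident], where c = 0 and S = S]]
  by simp

lemma C1_on_space_plus_time:
  fixes f :: "'a::euclidean_space \<Rightarrow> real" and k :: "real \<Rightarrow> real"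
  assumes "C1_on UNIV f f'" "C1_on UNIV k k'"
  shows "C1_on S (\<lambda>z. f (fst z - y) + k (snd z)) (\<lambda>z. (f' (fst z - y), k' (snd z)))"
proof -
  have "C1_on S (\<lambda>z::'a \<times> real. f (fst z + - y)) (\<lambda>z. (f' (fst z + - y), 0::real))"
    using assms(1) by (rule C1_on_compose_affine)
      (auto intro!: bounded_linear_fst bounded_linear_Pair bounded_linear_ident bounded_linear_zero
        simp: inner_prod_def)
  from C1_on_add[OF this C1_on_compose_snd[OF assms(2)]] show ?thesis by simp
qed

lemma C1_on_compose_real:
  assumes f: "C1_on S f f'" and k: "C1_on UNIV k k'"
  shows "C1_on S (\<lambda>z. k (f z)) (\<lambda>z. k' (f z) *\<^sub>R f' z)"
  unfolding C1_on_def
proof (intro conjI ballI)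
  fix z assume "z \<in> S"
  then have "(f has_derivative (\<lambda>h. f' z \<bullet> h)) (at z)" using f by (simp add: C1_on_def)
  moreover have "(k has_derivative (\<lambda>h. k' (f z) * h)) (at (f z))"
    using k by (simp add: C1_on_def)
  ultimately show "((\<lambda>z. k (f z)) has_derivative (\<lambda>h. (k' (f z) *\<^sub>R f' z) \<bullet> h)) (at z)"
    using has_derivative_compose[of f "\<lambda>h. f' z \<bullet> h" z UNIV k] by simp
next
  have "continuous_on S (\<lambda>z. k' (f z))"
    using continuous_on_compose2[of UNIV k' S f] C1_on_imp_continuous_on[OF f] k by (auto simp: C1_on_def)
  then show "continuous_on S (\<lambda>z. k' (f z) *\<^sub>R f' z)"
    using f by (auto simp: C1_on_def intro!: continuous_intros)
qed

lemma C1_on_inner_self: "C1_on S (\<lambda>x. x \<bullet> x) (\<lambda>x. 2 *\<^sub>R x)"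
  unfolding C1_on_def
  by (auto intro!: continuous_intros derivative_eq_intros simp: inner_commute)

lemma C1_on_pos_part_square: "C1_on UNIV (\<lambda>x::real. (max 0 (x - c))\<^sup>2) (\<lambda>x. 2 * max 0 (x - c))"
proof (rule C1_on_real)
  fix x
  consider (left) "x < c" | (kink) "x = c" | (right) "c < x" by linarith
  then show "((\<lambda>x. (max 0 (x - c))\<^sup>2) has_real_derivative 2 * max 0 (x - c)) (at x)"
  proof cases
    case left
    have "((\<lambda>x. 0) has_real_derivative 2 * max 0 (x - c)) (at x)"
      using left by (auto intro!: derivative_eq_intros)
    then show ?thesis
      by (rule has_field_derivative_transform_within_open[of _ _ _ "{..<c}"]) (use left in auto)
  next
    case kink
    have "((\<lambda>h. max 0 (h - c)) \<longlongrightarrow> max 0 (c - c)) (at c)" by (intro tendsto_intros)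
    moreover have "((max 0 (h - c))\<^sup>2 - (max 0 (c - c))\<^sup>2) / (h - c) = max 0 (h - c)" for h
      by (auto simp: max_def power2_eq_square)
    ultimately show ?thesis by (simp add: kink has_field_derivative_iff)
  next
    case right
    have "((\<lambda>x. (x - c)\<^sup>2) has_real_derivative 2 * max 0 (x - c)) (at x)"
      using right by (auto intro!: derivative_eq_intros)
    then show ?thesis
      by (rule has_field_derivative_transform_within_open[of _ _ _ "{c<..}"]) (use right in auto)
  qed
qed (intro continuous_intros)

definition smooth_norm :: "real \<Rightarrow> 'a::real_inner \<Rightarrow> real" where
  "smooth_norm e x = sqrt (e\<^sup>2 + x \<bullet> x)"

definition smooth_norm_grad :: "real \<Rightarrow> 'a::real_inner \<Rightarrow> 'a" where
  "smooth_norm_grad e x = (1 / smooth_norm e x) *\<^sub>R x"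

lemma smooth_norm_pos: "e \<noteq> 0 \<Longrightarrow> smooth_norm e x > 0"
  unfolding smooth_norm_def by (simp add: add_pos_nonneg)

lemma norm_less_smooth_norm: "e \<noteq> 0 \<Longrightarrow> norm x < smooth_norm e x"
  unfolding smooth_norm_def norm_eq_sqrt_inner by simp

lemma smooth_norm_le: "e \<ge> 0 \<Longrightarrow> smooth_norm e x \<le> norm x + e"
  using sqrt_sum_squares_le_sum[of e "norm x"]
  unfolding smooth_norm_def by (simp add: dot_square_norm add.commute)

lemma norm_smooth_norm_grad_less: "e \<noteq> 0 \<Longrightarrow> norm (smooth_norm_grad e x) < 1"
  using norm_less_smooth_norm[of e x] smooth_norm_pos[of e x]
  unfolding smooth_norm_grad_def by (simp add: field_simps)

lemma C1_on_smooth_norm: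
  fixes S :: "'a::euclidean_space set"
  assumes "e \<noteq> 0"
  shows "C1_on S (smooth_norm e) (smooth_norm_grad e)"
  unfolding C1_on_def
proof (intro conjI ballI)
  fix x :: 'a
  have pos: "e\<^sup>2 + x \<bullet> x > 0" for x :: 'a using assms by (simp add: add_pos_nonneg)
  have "((\<lambda>x. e\<^sup>2 + x \<bullet> x) has_derivative (\<lambda>h. 2 * (x \<bullet> h))) (at x)"
    by (auto intro!: derivative_eq_intros simp: inner_commute)
  from has_derivative_real_sqrt[OF pos this]
  show "(smooth_norm e has_derivative (\<lambda>h. smooth_norm_grad e x \<bullet> h)) (at x)"
    unfolding smooth_norm_grad_def smooth_norm_def[abs_def]
    by (rule has_derivative_eq_rhs) (auto simp: fun_eq_iff inverse_eq_divide)
  have "e\<^sup>2 + x \<bullet> x \<noteq> 0" for x :: 'a using pos[of x] by linarith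
  then show "continuous_on S (smooth_norm_grad e)"
    unfolding smooth_norm_grad_def[abs_def] smooth_norm_def by (intro continuous_intros) auto
qed

lemma C1_approximation_of_norm:
  assumes "0 < L" "0 < \<sigma>"
  obtains \<theta> :: "'a::euclidean_space \<Rightarrow> real" and \<theta>' where "C1_on UNIV \<theta> \<theta>'"
    "\<And>d. L * norm d \<le> \<theta> d" "\<And>d. \<theta> d \<le> L * norm d + \<sigma>" "\<And>d. norm (\<theta>' d) \<le> L"
proof
  show "C1_on UNIV (\<lambda>d::'a. L * smooth_norm (\<sigma> / L) d) (\<lambda>d. L *\<^sub>R smooth_norm_grad (\<sigma> / L) d)"
    using assms by (intro C1_on_cmult C1_on_smooth_norm) simp
  fix d :: 'a
  show "L * norm d \<le> L * smooth_norm (\<sigma> / L) d" "norm (L *\<^sub>R smooth_norm_grad (\<sigma> / L) d) \<le> L"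
    using norm_less_smooth_norm[of "\<sigma> / L" d] norm_smooth_norm_grad_less[of "\<sigma> / L" d] assms by auto
  have "L * smooth_norm (\<sigma> / L) d \<le> L * (norm d + \<sigma> / L)"
    using smooth_norm_le[of "\<sigma> / L" d] assms by (intro mult_left_mono) auto
  then show "L * smooth_norm (\<sigma> / L) d \<le> L * norm d + \<sigma>" using assms(1) by (simp add: distrib_left)
qed

lemma C1_on_smooth_norm_shift:
  fixes S :: "'a::euclidean_space set"
  assumes "e \<noteq> 0"
  shows "C1_on S (\<lambda>x. smooth_norm e (x - y)) (\<lambda>x. smooth_norm_grad e (x - y))"
  using C1_on_compose_affine[OF C1_on_smooth_norm[OF assms] bounded_linear_ident bounded_linear_ident,
      where c = "- y" and S = S] by simp

lemma strict_growth_test_function: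
  fixes f :: "real \<Rightarrow> real"
  assumes order: "t0 < t1" "t1 < t2" and growth: "c * (t1 - t0) < f t1 - f t0"
  obtains \<psi> \<psi>' where "C1_on UNIV \<psi> \<psi>'" "\<And>s. c < \<psi>' s"
    "f t0 - \<psi> t0 < f t1 - \<psi> t1" "f t2 - \<psi> t2 < f t1 - \<psi> t1"
proof -
  obtain b where b: "c < b" "b < (f t1 - f t0) / (t1 - t0)"
    using dense[of c "(f t1 - f t0) / (t1 - t0)"] order growth by (auto simp: less_divide_eq)
  define D where "D = (\<bar>f t2 - f t1 - b * (t2 - t1)\<bar> + 1) / (t2 - t1)\<^sup>2"
  have D: "D \<ge> 0" "D * (t2 - t1)\<^sup>2 = \<bar>f t2 - f t1 - b * (t2 - t1)\<bar> + 1"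
    using order by (auto simp: D_def)
  define \<psi> where "\<psi> s = b * s + D * (max 0 (s - t1))\<^sup>2" for s
  define \<psi>' where "\<psi>' s = b + D * (2 * max 0 (s - t1))" for s
  have "C1_on UNIV (\<lambda>s. b * s) (\<lambda>s::real. b)"
    by (rule C1_on_real) (auto intro!: derivative_eq_intros)
  from C1_on_add[OF this C1_on_cmult[OF C1_on_pos_part_square]]
  have "C1_on UNIV \<psi> \<psi>'" unfolding \<psi>_def[abs_def] \<psi>'_def[abs_def] by simp
  moreover have "c < \<psi>' s" for s
    using b(1) mult_nonneg_nonneg[OF D(1), of "2 * max 0 (s - t1)"] by (simp add: \<psi>'_def)
  moreover have "f t0 - \<psi> t0 < f t1 - \<psi> t1"
    using b(2) order by (simp add: \<psi>_def less_divide_eq algebra_simps)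
  moreover have "f t2 - \<psi> t2 < f t1 - \<psi> t1"
    using D(2) order by (simp add: \<psi>_def algebra_simps abs_if split: if_splits)
  ultimately show thesis by (rule that)
qed

subsection \<open>Penalised maxima on compact sets\<close>

lemma penalised_maxima_converge:
  fixes f q :: "'a::metric_space \<Rightarrow> real"
  assumes S: "compact S" and f: "continuous_on S f" and q: "continuous_on S q"
    and q_nonneg: "\<And>z. z \<in> S \<Longrightarrow> 0 \<le> q z" and z0: "z0 \<in> S" "q z0 = 0"
  obtains Z k z where "\<And>n. Z n \<in> S" "\<And>n. 0 \<le> k n" "\<And>n y. y \<in> S \<Longrightarrow> f y - k n * q y \<le> f (Z n) - k n * q (Z n)"
    "Z \<longlonglongrightarrow> z" "z \<in> S" "q z = 0" "\<And>y. y \<in> S \<Longrightarrow> q y = 0 \<Longrightarrow> f y \<le> f z"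
proof -
  have "\<exists>z\<in>S. \<forall>y\<in>S. f y - real (Suc n) * q y \<le> f z - real (Suc n) * q z" for n
    using z0 by (intro continuous_attains_sup S continuous_intros f q) auto
  then obtain Z where Z: "\<And>n. Z n \<in> S"
    and Z_max: "\<And>n y. y \<in> S \<Longrightarrow> f y - real (Suc n) * q y \<le> f (Z n) - real (Suc n) * q (Z n)"
    by metis
  obtain M where M: "\<And>z. z \<in> S \<Longrightarrow> \<bar>f z\<bar> \<le> M"
    using compact_imp_bounded[OF compact_continuous_image[OF f S]] by (auto simp: bounded_iff)
  have penalty_le: "real (Suc n) * q (Z n) \<le> f (Z n) - f y" if "y \<in> S" "q y = 0" for n y
    using Z_max[OF that(1), of n] that(2) by simp
  have "(\<lambda>n. q (Z n)) \<longlonglongrightarrow> 0"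
  proof (rule tendsto_sandwich[of "\<lambda>_. 0" _ _ "\<lambda>n. (2 * M) * inverse (real (Suc n))"])
    show "\<forall>\<^sub>F n in sequentially. q (Z n) \<le> (2 * M) * inverse (real (Suc n))"
    proof (intro always_eventually allI)
      fix n
      have "real (Suc n) * q (Z n) \<le> 2 * M" using penalty_le[OF z0, of n] M[OF Z[of n]] M[OF z0(1)] by linarith
      then show "q (Z n) \<le> (2 * M) * inverse (real (Suc n))" by (simp add: field_simps)
    qed
    show "(\<lambda>n. (2 * M) * inverse (real (Suc n))) \<longlonglongrightarrow> 0"
      by (rule tendsto_mult_right_zero[OF LIMSEQ_inverse_real_of_nat])
  qed (use q_nonneg Z in auto)
  moreover obtain z r where z: "z \<in> S" and r: "strict_mono r" and lim: "(Z \<circ> r) \<longlonglongrightarrow> z"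
    using S Z unfolding compact_def by metis
  ultimately have "(\<lambda>n. q ((Z \<circ> r) n)) \<longlonglongrightarrow> 0"
    using LIMSEQ_subseq_LIMSEQ[of "\<lambda>n. q (Z n)" 0 r] by (simp add: o_def)
  moreover have limit: "(\<lambda>n. g ((Z \<circ> r) n)) \<longlonglongrightarrow> g z" if "continuous_on S g" for g :: "'a \<Rightarrow> real"
    using continuous_on_tendsto_compose[OF that lim z] Z by simp
  ultimately have "q z = 0" using limit[OF q] LIMSEQ_unique by blast
  moreover have "f y \<le> f z" if "y \<in> S" "q y = 0" for y
  proof (rule LIMSEQ_le_const[OF limit[OF f]])
    have "f y \<le> f (Z n)" for n
    proof -
      have "0 \<le> real (Suc n) * q (Z n)" using q_nonneg[OF Z] by simp
      then show ?thesis using penalty_le[OF that, of n] by linarith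
    qed
    then show "\<exists>N. \<forall>n\<ge>N. f y \<le> f ((Z \<circ> r) n)" by simp
  qed
  ultimately show thesis
    using Z Z_max z lim by (intro that[of "Z \<circ> r" "\<lambda>n. real (Suc (r n))" z]) auto
qed

lemma continuous_on_curried:
  assumes f: "continuous_on (UNIV \<times> I) (\<lambda>(x, t). f x t)"
    and "continuous_on S a" "continuous_on S b" "\<And>z. z \<in> S \<Longrightarrow> b z \<in> I"
  shows "continuous_on S (\<lambda>z. f (a z) (b z))"
  using continuous_on_compose2[OF f, of S "\<lambda>z. (a z, b z)"] assms
  by (auto intro: continuous_on_Pair)

subsection \<open>Viscosity sub- and supersolutions\<close>

definition subsolution ::
  "real \<Rightarrow> ('a::euclidean_space \<Rightarrow> real \<Rightarrow> real \<Rightarrow> 'a \<Rightarrow> real) \<Rightarrow> ('a \<Rightarrow> real \<Rightarrow> real) \<Rightarrow> bool" where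
  "subsolution T H W \<longleftrightarrow> (\<forall>\<phi> g x t. C1_on UNIV \<phi> g \<longrightarrow> 0 < t \<longrightarrow> t < T \<longrightarrow>
     (\<exists>e>0. \<forall>y s. 0 < s \<and> s < T \<and> dist (y, s) (x, t) < e \<longrightarrow> W y s - \<phi> (y, s) \<le> W x t - \<phi> (x, t)) \<longrightarrow>
     snd (g (x, t)) + H x t (W x t) (fst (g (x, t))) \<le> 0)"

definition reflected :: "('a::euclidean_space \<Rightarrow> real \<Rightarrow> real \<Rightarrow> 'a \<Rightarrow> real) \<Rightarrow> 'a \<Rightarrow> real \<Rightarrow> real \<Rightarrow> 'a \<Rightarrow> real" where
  "reflected H x t v p = - H x t (- v) (- p)"

definition supersolution ::
  "real \<Rightarrow> ('a::euclidean_space \<Rightarrow> real \<Rightarrow> real \<Rightarrow> 'a \<Rightarrow> real) \<Rightarrow> ('a \<Rightarrow> real \<Rightarrow> real) \<Rightarrow> bool" where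
  "supersolution T H u \<longleftrightarrow> subsolution T (reflected H) (\<lambda>x t. - u x t)"

lemma subsolutionD:
  assumes "subsolution T H W" "C1_on UNIV \<phi> g" "0 < t" "t < T" and N: "(x, t) \<in> interior N"
    and max: "\<And>y s. (y, s) \<in> N \<Longrightarrow> W y s - \<phi> (y, s) \<le> W x t - \<phi> (x, t)"
  shows "snd (g (x, t)) + H x t (W x t) (fst (g (x, t))) \<le> 0"
proof -
  obtain e where "e > 0" "ball (x, t) e \<subseteq> N" using N by (auto simp: mem_interior)
  then have "\<exists>e>0. \<forall>y s. 0 < s \<and> s < T \<and> dist (y, s) (x, t) < e \<longrightarrow> W y s - \<phi> (y, s) \<le> W x t - \<phi> (x, t)"
    using max by (intro exI[of _ e]) (auto simp: dist_commute subset_iff)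
  then show ?thesis using assms(1-4) unfolding subsolution_def by blast
qed

lemma supersolutionD:
  assumes "supersolution T H u" "C1_on UNIV \<phi> g" "0 < t" "t < T" "(x, t) \<in> interior N"
    and min: "\<And>y s. (y, s) \<in> N \<Longrightarrow> u x t - \<phi> (x, t) \<le> u y s - \<phi> (y, s)"
  shows "0 \<le> snd (g (x, t)) + H x t (u x t) (fst (g (x, t)))"
proof -
  have "snd (- g (x, t)) + reflected H x t (- u x t) (fst (- g (x, t))) \<le> 0"
  proof (rule subsolutionD[where W = "\<lambda>x t. - u x t", OF _ C1_on_uminus[OF assms(2)] assms(3-5)])
    show "subsolution T (reflected H) (\<lambda>x t. - u x t)" using assms(1) by (simp add: supersolution_def)
    show "- u y s - - \<phi> (y, s) \<le> - u x t - - \<phi> (x, t)" if "(y, s) \<in> N" for y s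
      using min[OF that] by simp
  qed
  then show ?thesis by (simp add: reflected_def)
qed

lemma subsolutionI:
  assumes "\<And>\<phi> g x t N. C1_on UNIV \<phi> g \<Longrightarrow> 0 < t \<Longrightarrow> t < T \<Longrightarrow> (x, t) \<in> interior N \<Longrightarrow> N \<subseteq> UNIV \<times> {0<..<T} \<Longrightarrow>
    (\<And>y s. (y, s) \<in> N \<Longrightarrow> W y s - \<phi> (y, s) \<le> W x t - \<phi> (x, t)) \<Longrightarrow>
    snd (g (x, t)) + H x t (W x t) (fst (g (x, t))) \<le> 0"
  shows "subsolution T H W"
  unfolding subsolution_def
proof (intro allI impI)
  fix \<phi> g x t
  assume "C1_on UNIV \<phi> g" and t: "0 < t" "t < T"
    and "\<exists>e>0. \<forall>y s. 0 < s \<and> s < T \<and> dist (y, s) (x, t) < e \<longrightarrow> W y s - \<phi> (y, s) \<le> W x t - \<phi> (x, t)"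
  moreover from this obtain e where "e > 0"
    and max: "\<And>y s. 0 < s \<Longrightarrow> s < T \<Longrightarrow> dist (y, s) (x, t) < e \<Longrightarrow> W y s - \<phi> (y, s) \<le> W x t - \<phi> (x, t)" by blast
  moreover have "(x, t) \<in> interior (ball (x, t) e \<inter> UNIV \<times> {0<..<T})"
    using \<open>e > 0\<close> t by (intro interiorI[OF _ _ order_refl] open_Int open_Times) auto
  ultimately show "snd (g (x, t)) + H x t (W x t) (fst (g (x, t))) \<le> 0"
    by (intro assms[of \<phi> g t x "ball (x, t) e \<inter> UNIV \<times> {0<..<T}"]) (auto simp: dist_commute)
qed

lemma subsolution_mono_time:
  assumes "subsolution T H W" "T' \<le> T"
  shows "subsolution T' H W"
  using assms(2) by (intro subsolutionI subsolutionD[OF assms(1)]) auto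

lemma supersolution_mono_time: "supersolution T H u \<Longrightarrow> T' \<le> T \<Longrightarrow> supersolution T' H u"
  unfolding supersolution_def by (rule subsolution_mono_time)

lemma visc_solution_imp_subsolution: "visc_solution T H u0 u \<Longrightarrow> subsolution T H u"
  using C1_on_subset[OF _ subset_UNIV] unfolding visc_solution_def subsolution_def by blast

lemma visc_solution_imp_supersolution:
  assumes "visc_solution T H u0 u"
  shows "supersolution T H u"
  unfolding supersolution_def subsolution_def reflected_def
proof (intro allI impI)
  fix \<phi> g x t
  assume \<phi>: "C1_on UNIV \<phi> g" and t: "0 < t" "t < T"
    and "\<exists>e>0. \<forall>y s. 0 < s \<and> s < T \<and> dist (y, s) (x, t) < e \<longrightarrow> - u y s - \<phi> (y, s) \<le> - u x t - \<phi> (x, t)"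
  then obtain e where "e > 0"
    "\<forall>y s. 0 < s \<and> s < T \<and> dist (y, s) (x, t) < e \<longrightarrow> u x t - - \<phi> (x, t) \<le> u y s - - \<phi> (y, s)" by force
  moreover have "C1_on (UNIV \<times> {0<..<T}) (\<lambda>z. - \<phi> z) (\<lambda>z. - g z)"
    by (rule C1_on_subset[OF C1_on_uminus[OF \<phi>] subset_UNIV])
  ultimately have "snd (- g (x, t)) + H x t (u x t) (fst (- g (x, t))) \<ge> 0"
    using assms t unfolding visc_solution_def by blast
  then show "snd (g (x, t)) + - H x t (- (- u x t)) (- fst (g (x, t))) \<le> 0" by simp
qed

definition discounted ::
  "real \<Rightarrow> ('a::euclidean_space \<Rightarrow> real \<Rightarrow> real \<Rightarrow> 'a \<Rightarrow> real) \<Rightarrow> 'a \<Rightarrow> real \<Rightarrow> real \<Rightarrow> 'a \<Rightarrow> real" where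
  "discounted l H x t v p = l * v + H x t (exp (l * t) * v) (exp (l * t) *\<^sub>R p) / exp (l * t)"

lemma subsolution_discounted:
  fixes W :: "'a::euclidean_space \<Rightarrow> real \<Rightarrow> real"
  assumes sub: "subsolution T H W"
  shows "subsolution T (discounted l H) (\<lambda>x t. W x t / exp (l * t))"
proof (rule subsolutionI)
  fix \<phi> :: "'a \<times> real \<Rightarrow> real" and g x t N
  assume \<phi>: "C1_on UNIV \<phi> g" and t: "0 < t" "t < T" and N: "(x, t) \<in> interior N"
    and max: "\<And>y s. (y, s) \<in> N \<Longrightarrow> W y s / exp (l * s) - \<phi> (y, s) \<le> W x t / exp (l * t) - \<phi> (x, t)"
  define w where "w = W x t / exp (l * t)"
  define d where "d = w - \<phi> (x, t)"
  define \<Phi> where "\<Phi> z = exp (l * snd z) * (\<phi> z + d)" for z :: "'a \<times> real"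
  define \<Phi>' where "\<Phi>' z = exp (l * snd z) *\<^sub>R g z + (\<phi> z + d) *\<^sub>R (0, l * exp (l * snd z))" for z
  have "C1_on UNIV (\<lambda>r. exp (l * r)) (\<lambda>r. l * exp (l * r))"
    by (rule C1_on_real) (auto intro!: derivative_eq_intros continuous_intros)
  then have \<Phi>: "C1_on UNIV \<Phi> \<Phi>'"
    unfolding \<Phi>_def[abs_def] \<Phi>'_def[abs_def] by (intro C1_on_mult C1_on_compose_snd C1_on_add_const \<phi>)
  have grad: "fst (\<Phi>' (x, t)) = exp (l * t) *\<^sub>R fst (g (x, t))"
    "snd (\<Phi>' (x, t)) = exp (l * t) * (snd (g (x, t)) + l * w)"
    by (simp_all add: \<Phi>'_def d_def algebra_simps)
  have "W y s - \<Phi> (y, s) \<le> W x t - \<Phi> (x, t)" if "(y, s) \<in> N" for y s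
  proof -
    have "W y s / exp (l * s) \<le> \<phi> (y, s) + d" using max[OF that] by (simp add: d_def w_def)
    then have "W y s \<le> \<Phi> (y, s)" by (simp add: \<Phi>_def divide_le_eq mult.commute)
    moreover have "\<Phi> (x, t) = W x t" by (simp add: \<Phi>_def d_def w_def)
    ultimately show ?thesis by simp
  qed
  from subsolutionD[OF sub \<Phi> t N this]
  have "snd (\<Phi>' (x, t)) + H x t (W x t) (fst (\<Phi>' (x, t))) \<le> 0" .
  moreover have "exp (l * t) * w = W x t" by (simp add: w_def)
  ultimately show "snd (g (x, t)) + discounted l H x t (W x t / exp (l * t)) (fst (g (x, t))) \<le> 0"
    unfolding discounted_def grad w_def[symmetric] by (simp add: field_simps)
qed

lemma supersolution_discounted:
  assumes "supersolution T H u"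
  shows "supersolution T (discounted l H) (\<lambda>x t. u x t / exp (l * t))"
proof -
  have "reflected (discounted l H) = discounted l (reflected H)"
    by (simp add: fun_eq_iff reflected_def discounted_def)
  then show ?thesis
    using subsolution_discounted[of T "reflected H" "\<lambda>x t. - u x t" l] assms
    by (simp add: supersolution_def)
qed

subsection \<open>Doubling of variables\<close>

definition doubled_gap ::
  "('a \<Rightarrow> real \<Rightarrow> real) \<Rightarrow> ('a \<Rightarrow> real \<Rightarrow> real) \<Rightarrow> ('a \<Rightarrow> real) \<Rightarrow> ('a \<times> real \<Rightarrow> real) \<Rightarrow>
    'a::euclidean_space \<times> real \<Rightarrow> 'a \<times> real \<Rightarrow> real" where
  "doubled_gap W u \<theta> \<Gamma> a b = W (fst a) (snd a) - u (fst b) (snd b) - \<theta> (fst a - fst b) - \<Gamma> a - \<Gamma> b"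

definition doubled_residual ::
  "('a \<Rightarrow> real \<Rightarrow> real \<Rightarrow> 'a \<Rightarrow> real) \<Rightarrow> ('a \<Rightarrow> real \<Rightarrow> real) \<Rightarrow> ('a \<Rightarrow> real \<Rightarrow> real) \<Rightarrow> ('a \<Rightarrow> 'a) \<Rightarrow>
    ('a \<times> real \<Rightarrow> 'a \<times> real) \<Rightarrow> 'a::euclidean_space \<times> real \<Rightarrow> 'a \<times> real \<Rightarrow> real" where
  "doubled_residual H W u \<theta>' \<gamma> a b = snd (\<gamma> a) + snd (\<gamma> b)
    + H (fst a) (snd a) (W (fst a) (snd a)) (\<theta>' (fst a - fst b) + fst (\<gamma> a))
    - H (fst b) (snd b) (u (fst b) (snd b)) (\<theta>' (fst a - fst b) - fst (\<gamma> b))"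

lemma doubled_residual_nonpos:
  fixes W u :: "'a::euclidean_space \<Rightarrow> real \<Rightarrow> real"
  assumes sub: "subsolution T H W" and super: "supersolution T H u"
    and \<theta>: "C1_on UNIV \<theta> \<theta>'" and \<Gamma>: "C1_on UNIV \<Gamma> \<gamma>"
    and times: "0 < snd a" "snd a < T" "0 < snd b" "snd b < T"
    and interior: "a \<in> interior N" "b \<in> interior N"
    and max: "\<And>a' b'. a' \<in> N \<Longrightarrow> b' \<in> N \<Longrightarrow>
      doubled_gap W u \<theta> \<Gamma> a' b' - k * (snd a' - snd b')\<^sup>2 \<le> doubled_gap W u \<theta> \<Gamma> a b - k * (snd a - snd b)\<^sup>2"
  shows "doubled_residual H W u \<theta>' \<gamma> a b \<le> 0"
proof -
  obtain x t y s where ab: "a = (x, t)" "b = (y, s)" by (metis prod.collapse)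
  have in_N: "a \<in> N" "b \<in> N" using interior interior_subset by blast+
  have square: "C1_on UNIV (\<lambda>r. c * (r - r0)\<^sup>2) (\<lambda>r. c * (2 * (r - r0)))" for c r0 :: real
    by (rule C1_on_real) (auto intro!: derivative_eq_intros continuous_intros)
  have "2 * k * (t - s) + snd (\<gamma> (x, t)) + H x t (W x t) (\<theta>' (x - y) + fst (\<gamma> (x, t))) \<le> 0"
    using subsolutionD[OF sub C1_on_add[OF C1_on_space_plus_time[OF \<theta> square[of k s], of _ y] \<Gamma>], of t x N]
      times interior max[OF _ in_N(2)] by (fastforce simp: ab doubled_gap_def algebra_simps)
  moreover have "0 \<le> 2 * k * (t - s) - snd (\<gamma> (y, s)) + H y s (u y s) (\<theta>' (x - y) - fst (\<gamma> (y, s)))"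
    using supersolutionD[OF super C1_on_add[OF C1_on_space_plus_time[OF C1_on_point_reflection[OF \<theta>] square[of "- k" t],
        of _ x]
          C1_on_uminus[OF \<Gamma>]], of s y N] times interior max[OF in_N(1)]
    by (fastforce simp: ab doubled_gap_def algebra_simps power2_commute)
  ultimately show ?thesis by (simp add: ab doubled_residual_def)
qed

lemma continuous_on_doubled_gap:
  fixes W u :: "'a::euclidean_space \<Rightarrow> real \<Rightarrow> real"
  assumes W: "continuous_on (UNIV \<times> I) (\<lambda>(x, t). W x t)" and u: "continuous_on (UNIV \<times> I) (\<lambda>(x, t). u x t)"
    and \<theta>: "continuous_on UNIV \<theta>" and \<Gamma>: "continuous_on UNIV \<Gamma>" and N: "N \<subseteq> UNIV \<times> I"
  shows "continuous_on (N \<times> N) (\<lambda>z. doubled_gap W u \<theta> \<Gamma> (fst z) (snd z))"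
  unfolding doubled_gap_def using N
  by (intro continuous_intros continuous_on_curried[OF W] continuous_on_curried[OF u]
      continuous_on_compose2[OF \<theta>] continuous_on_compose2[OF \<Gamma>]) auto

locale hamiltonian =
  fixes T :: real and H :: "'a::euclidean_space \<Rightarrow> real \<Rightarrow> real \<Rightarrow> 'a \<Rightarrow> real" and C \<beta> A B :: real
  assumes continuous_H: "continuous_on (UNIV \<times> {0..T} \<times> UNIV \<times> UNIV) (\<lambda>(x, t, v, p). H x t v p)"
    and nonneg: "0 \<le> C" "0 \<le> \<beta>" "0 \<le> A" "0 \<le> B"
    and H_space: "t \<in> {0..T} \<Longrightarrow> \<bar>H x t v p - H y t v p\<bar> \<le> C * (\<beta> + norm p) * dist x y"
    and H_momentum: "t \<in> {0..T} \<Longrightarrow> \<bar>H x t v p - H x t v q\<bar> \<le> (A * norm x + B) * dist p q"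
begin

lemma continuous_on_H:
  assumes "continuous_on S x" "continuous_on S t" "continuous_on S v" "continuous_on S p"
    and "\<And>z. z \<in> S \<Longrightarrow> t z \<in> {0..T}"
  shows "continuous_on S (\<lambda>z. H (x z) (t z) (v z) (p z))"
proof -
  have arguments: "continuous_on S (\<lambda>z. (x z, t z, v z, p z))" using assms(1-4) by (intro continuous_on_Pair)
  have "(\<lambda>z. (x z, t z, v z, p z)) ` S \<subseteq> UNIV \<times> {0..T} \<times> UNIV \<times> UNIV" using assms(5) by auto
  from continuous_on_compose2[OF continuous_H arguments this] show ?thesis by simp
qed

lemma continuous_on_doubled_residual:
  assumes W: "continuous_on (UNIV \<times> {0..<T}) (\<lambda>(x, t). W x t)"
    and u: "continuous_on (UNIV \<times> {0..<T}) (\<lambda>(x, t). u x t)"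
    and \<theta>': "continuous_on UNIV \<theta>'" and \<gamma>: "continuous_on UNIV \<gamma>" and N: "N \<subseteq> UNIV \<times> {0..<T}"
  shows "continuous_on (N \<times> N) (\<lambda>z. doubled_residual H W u \<theta>' \<gamma> (fst z) (snd z))"
  unfolding doubled_residual_def using N
  by (intro continuous_intros continuous_on_H continuous_on_curried[OF W] continuous_on_curried[OF u]
      continuous_on_compose2[OF \<theta>'] continuous_on_compose2[OF \<gamma>]) fastforce+

lemma doubling_of_variables:
  assumes sub: "subsolution T H W" and super: "supersolution T H u"
    and W: "continuous_on (UNIV \<times> {0..<T}) (\<lambda>(x, t). W x t)"
    and u: "continuous_on (UNIV \<times> {0..<T}) (\<lambda>(x, t). u x t)"
    and \<theta>: "C1_on UNIV \<theta> \<theta>'" and \<Gamma>: "C1_on UNIV \<Gamma> \<gamma>"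
    and N: "compact N" "N \<subseteq> UNIV \<times> {0..<T}" and base: "(xb, tb) \<in> N" "(yb, tb) \<in> N"
    and inside: "\<And>x y t. (x, t) \<in> N \<Longrightarrow> (y, t) \<in> N \<Longrightarrow>
      doubled_gap W u \<theta> \<Gamma> (xb, tb) (yb, tb) \<le> doubled_gap W u \<theta> \<Gamma> (x, t) (y, t) \<Longrightarrow>
      0 < t \<and> (x, t) \<in> interior N \<and> (y, t) \<in> interior N"
  obtains x y t where "(x, t) \<in> N" "(y, t) \<in> N"
    "doubled_gap W u \<theta> \<Gamma> (xb, tb) (yb, tb) \<le> doubled_gap W u \<theta> \<Gamma> (x, t) (y, t)"
    "doubled_residual H W u \<theta>' \<gamma> (x, t) (y, t) \<le> 0"
proof -
  let ?gap = "\<lambda>z. doubled_gap W u \<theta> \<Gamma> (fst z) (snd z)"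
  let ?res = "\<lambda>z. doubled_residual H W u \<theta>' \<gamma> (fst z) (snd z)"
  have gap: "continuous_on (N \<times> N) ?gap"
    by (intro continuous_on_doubled_gap[OF W u _ _ N(2)]
        C1_on_imp_continuous_on[OF \<theta>] C1_on_imp_continuous_on[OF \<Gamma>])
  have res: "continuous_on (N \<times> N) ?res"
    by (intro continuous_on_doubled_residual[OF W u _ _ N(2)] C1_on_imp_continuous_on_gradient[OF \<theta>]
        C1_on_imp_continuous_on_gradient[OF \<Gamma>])
  have time_gap: "continuous_on (N \<times> N) (\<lambda>z. (snd (fst z) - snd (snd z))\<^sup>2)" by (intro continuous_intros)
  obtain Z k z where Z: "\<And>n. Z n \<in> N \<times> N"
    and Z_max: "\<And>n y. y \<in> N \<times> N \<Longrightarrow> ?gap y - k n * (snd (fst y) - snd (snd y))\<^sup>2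
      \<le> ?gap (Z n) - k n * (snd (fst (Z n)) - snd (snd (Z n)))\<^sup>2"
    and lim: "Z \<longlonglongrightarrow> z" and z: "z \<in> N \<times> N" "(snd (fst z) - snd (snd z))\<^sup>2 = 0"
    and z_max: "\<And>y. y \<in> N \<times> N \<Longrightarrow> (snd (fst y) - snd (snd y))\<^sup>2 = 0 \<Longrightarrow> ?gap y \<le> ?gap z"
    using penalised_maxima_converge[OF compact_Times[OF N(1) N(1)] gap time_gap, of "((xb, tb), (yb, tb))"] base
    by (simp, metis)
  obtain x t y where z_eq: "z = ((x, t), (y, t))" using z(2) by (cases z) auto
  have in_N: "(x, t) \<in> N" "(y, t) \<in> N" using z(1) by (auto simp: z_eq)
  have base_le: "doubled_gap W u \<theta> \<Gamma> (xb, tb) (yb, tb) \<le> doubled_gap W u \<theta> \<Gamma> (x, t) (y, t)"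
    using z_max[of "((xb, tb), (yb, tb))"] base by (simp add: z_eq)
  define V where "V = interior N \<inter> UNIV \<times> {0<..}"
  have "open (V \<times> V)" unfolding V_def by (intro open_Times open_Int open_interior open_UNIV open_greaterThan)
  moreover have "z \<in> V \<times> V" using inside[OF in_N base_le] by (simp add: z_eq V_def)
  ultimately have "\<forall>\<^sub>F n in sequentially. Z n \<in> V \<times> V" using topological_tendstoD[OF lim] by blast
  then have "\<forall>\<^sub>F n in sequentially. ?res (Z n) \<le> 0"
  proof eventually_elim
    case (elim n)
    have max: "doubled_gap W u \<theta> \<Gamma> a b - k n * (snd a - snd b)\<^sup>2
        \<le> ?gap (Z n) - k n * (snd (fst (Z n)) - snd (snd (Z n)))\<^sup>2" if "a \<in> N" "b \<in> N" for a b
      using Z_max[of "(a, b)" n] that by simp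
    show ?case
      by (rule doubled_residual_nonpos[OF sub super \<theta> \<Gamma> _ _ _ _ _ _ max])
        (use elim Z[of n] N(2) in \<open>auto simp: V_def mem_Times_iff\<close>)
  qed
  moreover have "(\<lambda>n. ?res (Z n)) \<longlonglongrightarrow> ?res z"
    using continuous_on_tendsto_compose[OF res lim z(1)] Z by simp
  ultimately have "?res z \<le> 0" using tendsto_upperbound[OF _ _ sequentially_bot] by blast
  then show thesis using that[OF in_N base_le] by (simp add: z_eq)
qed

end

subsection \<open>Comparison in dependence cones\<close>

definition exp_primitive :: "real \<Rightarrow> real \<Rightarrow> real" where
  "exp_primitive A t = (if A = 0 then t else (exp (A * t) - 1) / A)"

lemma exp_primitive_nonneg: "0 \<le> A \<Longrightarrow> 0 \<le> t \<Longrightarrow> 0 \<le> exp_primitive A t"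
  by (simp add: exp_primitive_def)

lemma C1_on_exp_primitive: "C1_on UNIV (exp_primitive A) (\<lambda>t. exp (A * t))"
proof (rule C1_on_real)
  show "(exp_primitive A has_real_derivative exp (A * t)) (at t)" for t
    unfolding exp_primitive_def[abs_def] by (cases "A = 0") (auto intro!: derivative_eq_intros)
qed (intro continuous_intros)

locale cone_gauge =
  fixes A B \<nu> D t0 :: real and x0 :: "'a::euclidean_space"
  assumes speed_nonneg: "0 \<le> A" "0 \<le> B" and smoothing_pos: "0 < \<nu>" and penalty_nonneg: "0 \<le> D"
begin

text \<open>Sublevel sets of \<open>gauge\<close> are dependence cones whose lateral boundary moves inwards at least at
  the speed \<open>A * norm x + B\<close>; the term with \<open>D\<close> closes them shortly after time \<open>t0\<close>.\<close>

definition gauge :: "'a \<times> real \<Rightarrow> real" where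
  "gauge z = exp (A * snd z) * smooth_norm \<nu> (fst z - x0)
    + ((A * norm x0 + B) * exp_primitive A (snd z) + D * (max 0 (snd z - t0))\<^sup>2)"

definition gauge_grad :: "'a \<times> real \<Rightarrow> 'a \<times> real" where
  "gauge_grad z = (exp (A * snd z) *\<^sub>R smooth_norm_grad \<nu> (fst z - x0),
    exp (A * snd z) * (A * smooth_norm \<nu> (fst z - x0) + (A * norm x0 + B)) + D * (2 * max 0 (snd z - t0)))"

lemma C1_on_gauge: "C1_on UNIV gauge gauge_grad"
proof -
  have space: "C1_on UNIV (\<lambda>z::'a \<times> real. smooth_norm \<nu> (fst z - x0))
      (\<lambda>z. (smooth_norm_grad \<nu> (fst z - x0), 0))"
    using C1_on_space_plus_time[OF C1_on_smooth_norm C1_on_real[of "\<lambda>_. 0" "\<lambda>_. 0"], of \<nu> UNIV x0]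
      smoothing_pos by simp
  have growth: "C1_on UNIV (\<lambda>r. exp (A * r)) (\<lambda>r. A * exp (A * r))"
    by (rule C1_on_real) (auto intro!: derivative_eq_intros continuous_intros)
  have drift: "C1_on UNIV (\<lambda>r. (A * norm x0 + B) * exp_primitive A r + D * (max 0 (r - t0))\<^sup>2)
      (\<lambda>r. (A * norm x0 + B) *\<^sub>R exp (A * r) + D *\<^sub>R (2 * max 0 (r - t0)))"
    by (intro C1_on_add C1_on_cmult C1_on_exp_primitive C1_on_pos_part_square)
  from C1_on_add[OF C1_on_mult[OF C1_on_compose_snd[OF growth] space] C1_on_compose_snd[OF drift]]
  show ?thesis
    by (simp add: gauge_def[abs_def] gauge_grad_def[abs_def] distrib_left mult_ac add_ac)
qed

lemma gauge_speed: "(A * norm x + B) * norm (fst (gauge_grad (x, t))) \<le> snd (gauge_grad (x, t))"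
proof -
  have "norm x \<le> smooth_norm \<nu> (x - x0) + norm x0"
    using norm_triangle_ineq[of "x - x0" x0] norm_less_smooth_norm[of \<nu> "x - x0"] smoothing_pos by simp
  then have "A * norm x \<le> A * (smooth_norm \<nu> (x - x0) + norm x0)" using speed_nonneg(1) by (rule mult_left_mono)
  then have speed: "A * norm x + B \<le> A * smooth_norm \<nu> (x - x0) + (A * norm x0 + B)" by (simp add: distrib_left)
  have "norm (fst (gauge_grad (x, t))) \<le> exp (A * t)"
    using norm_smooth_norm_grad_less[of \<nu> "x - x0"] smoothing_pos by (simp add: gauge_grad_def)
  then have "(A * norm x + B) * norm (fst (gauge_grad (x, t))) \<le> (A * norm x + B) * exp (A * t)"
    using speed_nonneg by (intro mult_left_mono) auto
  also have "\<dots> \<le> (A * smooth_norm \<nu> (x - x0) + (A * norm x0 + B)) * exp (A * t)"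
    using speed by (intro mult_right_mono) auto
  also have "\<dots> \<le> snd (gauge_grad (x, t))" using penalty_nonneg by (simp add: gauge_grad_def mult.commute)
  finally show ?thesis .
qed

lemma gauge_ge:
  assumes "0 \<le> snd z"
  shows "dist (fst z) x0 \<le> gauge z" "D * (max 0 (snd z - t0))\<^sup>2 \<le> gauge z"
proof -
  have "norm (fst z - x0) \<le> smooth_norm \<nu> (fst z - x0)"
    using norm_less_smooth_norm[of \<nu> "fst z - x0"] smoothing_pos by simp
  also have "\<dots> \<le> exp (A * snd z) * smooth_norm \<nu> (fst z - x0)"
    using smooth_norm_pos[of \<nu> "fst z - x0"] smoothing_pos assms speed_nonneg(1) by simp
  finally have space: "norm (fst z - x0) \<le> exp (A * snd z) * smooth_norm \<nu> (fst z - x0)" .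
  have "0 \<le> (A * norm x0 + B) * exp_primitive A (snd z)"
    using speed_nonneg exp_primitive_nonneg[OF speed_nonneg(1) assms] by simp
  moreover have "0 \<le> D * (max 0 (snd z - t0))\<^sup>2" using penalty_nonneg by simp
  ultimately show "dist (fst z) x0 \<le> gauge z" "D * (max 0 (snd z - t0))\<^sup>2 \<le> gauge z"
    using space norm_ge_zero[of "fst z - x0"] unfolding gauge_def dist_norm by linarith+
qed

lemma gauge_le:
  assumes "t \<le> t0"
  shows "gauge (x, t) \<le> exp (A * t) * (dist x x0 + \<nu>) + (A * norm x0 + B) * exp_primitive A t"
  using smooth_norm_le[of \<nu> "x - x0"] smoothing_pos assms by (simp add: gauge_def dist_norm)

lemma gauge_sublevel:
  assumes "t0 < T" "R < D * (T - t0)\<^sup>2"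
  shows "{z. 0 \<le> snd z \<and> gauge z \<le> R} \<subseteq> cball x0 R \<times> {0..T}" "compact {z. 0 \<le> snd z \<and> gauge z \<le> R}"
proof -
  show sub: "{z. 0 \<le> snd z \<and> gauge z \<le> R} \<subseteq> cball x0 R \<times> {0..T}"
  proof
    fix z assume z: "z \<in> {z. 0 \<le> snd z \<and> gauge z \<le> R}"
    have "snd z \<le> T"
    proof (rule ccontr)
      assume "\<not> snd z \<le> T"
      then have "(T - t0)\<^sup>2 \<le> (max 0 (snd z - t0))\<^sup>2" using assms(1) by (intro power_mono) auto
      then have "D * (T - t0)\<^sup>2 \<le> D * (max 0 (snd z - t0))\<^sup>2" using penalty_nonneg by (rule mult_left_mono)
      then show False using gauge_ge(2)[of z] z assms(2) by simp
    qed
    then show "z \<in> cball x0 R \<times> {0..T}" using gauge_ge(1)[of z] z by (auto simp: mem_Times_iff dist_commute)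
  qed
  have "closed {z. 0 \<le> snd z \<and> gauge z \<le> R}"
    using C1_on_imp_continuous_on[OF C1_on_gauge]
    by (intro closed_Collect_conj closed_Collect_le continuous_intros)
  from compact_Int_closed[OF compact_Times[OF compact_cball[of x0 R] compact_Icc[of 0 T]] this]
  show "compact {z. 0 \<le> snd z \<and> gauge z \<le> R}" by (simp only: Int_absorb1[OF sub])
qed

lemma gauge_barrier:
  assumes "0 \<le> M" "R1 < R"
  obtains \<Gamma> \<gamma> where "C1_on UNIV \<Gamma> \<gamma>" "\<And>z. 0 \<le> \<Gamma> z" "\<And>z. gauge z \<le> R1 \<Longrightarrow> \<Gamma> z = 0" "\<And>z. gauge z = R \<Longrightarrow> \<Gamma> z = M"
    "\<And>x s. (A * norm x + B) * norm (fst (\<gamma> (x, s))) \<le> snd (\<gamma> (x, s))"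
proof -
  define m where "m = M / (R - R1)\<^sup>2"
  have m: "0 \<le> m" "m * (R - R1)\<^sup>2 = M" using assms by (auto simp: m_def)
  define \<Gamma> where "\<Gamma> z = m * (max 0 (gauge z - R1))\<^sup>2" for z
  define \<gamma> where "\<gamma> z = (m * (2 * max 0 (gauge z - R1))) *\<^sub>R gauge_grad z" for z
  show thesis
  proof (rule that)
    show "C1_on UNIV \<Gamma> \<gamma>"
      using C1_on_compose_real[OF C1_on_gauge C1_on_cmult[OF C1_on_pos_part_square]]
      by (simp add: \<Gamma>_def[abs_def] \<gamma>_def[abs_def])
    show "(A * norm x + B) * norm (fst (\<gamma> (x, s))) \<le> snd (\<gamma> (x, s))" for x s
      using mult_left_mono[OF gauge_speed[of x s], of "m * (2 * max 0 (gauge (x, s) - R1))"] m(1)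
      by (simp add: \<gamma>_def abs_mult mult_ac)
  qed (use m assms(2) in \<open>auto simp: \<Gamma>_def\<close>)
qed

end

lemma cone_barrier:
  fixes xb yb :: "'a::euclidean_space"
  assumes AB: "0 \<le> A" "0 \<le> B" and t: "0 \<le> t" "t < T" and M: "0 \<le> M"
    and cone: "exp (A * t) * dist yb xb + (A * norm xb + B) * exp_primitive A t < R"
  obtains N \<Gamma> \<gamma> where "compact N" "N \<subseteq> cball xb R \<times> {0..T}" "(xb, t) \<in> N" "(yb, t) \<in> N"
    "C1_on UNIV \<Gamma> \<gamma>" "\<And>z. 0 \<le> \<Gamma> z" "\<Gamma> (xb, t) = 0" "\<Gamma> (yb, t) = 0"
    "\<And>x s. (A * norm x + B) * norm (fst (\<gamma> (x, s))) \<le> snd (\<gamma> (x, s))"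
    "\<And>z. z \<in> N \<Longrightarrow> 0 < snd z \<Longrightarrow> z \<in> interior N \<or> M \<le> \<Gamma> z"
proof -
  define R0 where "R0 = exp (A * t) * dist yb xb + (A * norm xb + B) * exp_primitive A t"
  define \<nu> where "\<nu> = (R - R0) / (2 * exp (A * t))"
  define R1 where "R1 = (R + R0) / 2"
  define D where "D = (R + 1) / (T - t)\<^sup>2"
  have R: "0 \<le> R0" "R0 < R" "R1 < R"
    using cone AB exp_primitive_nonneg[OF AB(1) t(1)] by (auto simp: R0_def R1_def)
  interpret cone_gauge A B \<nu> D t xb
    using AB R by unfold_locales (auto simp: \<nu>_def D_def)
  define N where "N = {z. 0 \<le> snd z \<and> gauge z \<le> R}"
  have N: "N \<subseteq> cball xb R \<times> {0..T}" "compact N"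
    using gauge_sublevel[of T R] t unfolding N_def by (auto simp: D_def)
  have vertex: "gauge (x, t) \<le> R1" if "dist x xb \<le> dist yb xb" for x
  proof -
    have "gauge (x, t) \<le> exp (A * t) * (dist yb xb + \<nu>) + (A * norm xb + B) * exp_primitive A t"
      using gauge_le[of t x] that by (smt (verit) exp_gt_zero mult_left_mono)
    also have "\<dots> = R1" by (simp add: R0_def R1_def \<nu>_def field_simps)
    finally show ?thesis .
  qed
  obtain \<Gamma> \<gamma> where \<Gamma>: "C1_on UNIV \<Gamma> \<gamma>" "\<And>z. 0 \<le> \<Gamma> z" "\<And>z. gauge z \<le> R1 \<Longrightarrow> \<Gamma> z = 0" "\<And>z. gauge z = R \<Longrightarrow> \<Gamma> z = M"
    and speed: "\<And>x s. (A * norm x + B) * norm (fst (\<gamma> (x, s))) \<le> snd (\<gamma> (x, s))"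
    by (rule gauge_barrier[OF M R(3)]) (rule that)
  have "z \<in> interior N \<or> M \<le> \<Gamma> z" if "z \<in> N" "0 < snd z" for z
  proof (cases "gauge z < R")
    case True
    have "open {z. 0 < snd z \<and> gauge z < R}"
      using C1_on_imp_continuous_on[OF C1_on_gauge]
      by (intro open_Collect_conj open_Collect_less continuous_intros)
    then show ?thesis using True that by (intro disjI1 interiorI) (auto simp: N_def)
  next
    case False
    then show ?thesis using that \<Gamma>(4)[of z] by (simp add: N_def)
  qed
  moreover have "gauge (xb, t) \<le> R1" "gauge (yb, t) \<le> R1" using vertex by auto
  ultimately show thesis
    using that[OF N(2,1) _ _ \<Gamma>(1,2) _ _ speed] \<Gamma>(3) R(3) t by (simp add: N_def)
qed

lemma difference_bounded_above:
  fixes W u :: "'a::metric_space \<Rightarrow> real \<Rightarrow> real"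
  assumes "continuous_on (UNIV \<times> I) (\<lambda>(x, t). W x t)" "continuous_on (UNIV \<times> I) (\<lambda>(x, t). u x t)"
    and S: "compact S" "S \<subseteq> UNIV \<times> I"
  obtains M where "0 \<le> M" "\<And>a b. a \<in> S \<Longrightarrow> b \<in> S \<Longrightarrow> W (fst a) (snd a) - u (fst b) (snd b) \<le> M"
proof -
  have bounded: "\<exists>M. \<forall>z\<in>S. \<bar>w (fst z) (snd z)\<bar> \<le> M"
    if "continuous_on (UNIV \<times> I) (\<lambda>(x, t). w x t)" for w :: "'a \<Rightarrow> real \<Rightarrow> real"
  proof -
    have "continuous_on S (\<lambda>z. w (fst z) (snd z))"
      using S(2) by (intro continuous_on_curried[OF that] continuous_intros) auto
    from compact_imp_bounded[OF compact_continuous_image[OF this S(1)]] show ?thesis by (auto simp: bounded_iff)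
  qed
  obtain MW where MW: "\<And>z. z \<in> S \<Longrightarrow> \<bar>W (fst z) (snd z)\<bar> \<le> MW" using bounded[OF assms(1)] by blast
  obtain Mu where Mu: "\<And>z. z \<in> S \<Longrightarrow> \<bar>u (fst z) (snd z)\<bar> \<le> Mu" using bounded[OF assms(2)] by blast
  have "W (fst a) (snd a) - u (fst b) (snd b) \<le> \<bar>MW\<bar> + \<bar>Mu\<bar>" if "a \<in> S" "b \<in> S" for a b
    using MW[OF that(1)] Mu[OF that(2)] by linarith
  then show thesis by (intro that[of "\<bar>MW\<bar> + \<bar>Mu\<bar>"]) auto
qed

lemma doubled_gap_pos_imp_interior:
  assumes in_N: "(x, t) \<in> N" "(y, t) \<in> N" and gap_pos: "0 < doubled_gap W u \<theta> \<Gamma> (x, t) (y, t)"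
    and "0 < L" and \<theta>_ge: "\<And>d. L * norm d \<le> \<theta> d" and \<Gamma>_nonneg: "\<And>z. 0 \<le> \<Gamma> z" and "0 \<le> t"
    and bound: "W x t - u y t \<le> M" and init: "W x 0 - u y 0 \<le> L * norm (x - y)"
    and lateral: "\<And>z. z \<in> N \<Longrightarrow> 0 < snd z \<Longrightarrow> z \<in> interior N \<or> M \<le> \<Gamma> z"
  shows "0 < t \<and> (x, t) \<in> interior N \<and> (y, t) \<in> interior N"
proof -
  have gap: "L * norm (x - y) + \<Gamma> (x, t) + \<Gamma> (y, t) < W x t - u y t"
    using gap_pos \<theta>_ge[of "x - y"] by (simp add: doubled_gap_def)
  moreover have "0 \<le> L * norm (x - y)" using \<open>0 < L\<close> by simp
  ultimately have "\<Gamma> (x, t) < M" "\<Gamma> (y, t) < M"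
    using bound \<Gamma>_nonneg[of "(x, t)"] \<Gamma>_nonneg[of "(y, t)"] by linarith+
  moreover have "t \<noteq> 0" using gap init \<Gamma>_nonneg[of "(x, t)"] \<Gamma>_nonneg[of "(y, t)"] by auto
  ultimately show ?thesis using lateral[OF in_N(1)] lateral[OF in_N(2)] \<open>0 \<le> t\<close> by auto
qed

context hamiltonian
begin

lemma doubled_residual_gap:
  assumes proper: "\<And>v w p. v \<le> w \<Longrightarrow> l * (w - v) \<le> H x t w p - H x t v p"
    and t: "t \<in> {0..T}" and order: "u y t \<le> W x t" and L: "norm (\<theta>' (x - y)) \<le> L" "\<beta> \<le> L"
    and barrier: "\<And>x. (A * norm x + B) * norm (fst (\<gamma> (x, t))) \<le> snd (\<gamma> (x, t))"
    and residual: "doubled_residual H W u \<theta>' \<gamma> (x, t) (y, t) \<le> 0"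
  shows "l * (W x t - u y t) \<le> 2 * C * (L * dist x y)"
proof -
  let ?p = "\<theta>' (x - y)"
  have "H x t (W x t) ?p \<le> H x t (W x t) (?p + fst (\<gamma> (x, t))) + snd (\<gamma> (x, t))"
    using H_momentum[OF t, of x "W x t" ?p "?p + fst (\<gamma> (x, t))"] barrier[of x] by (simp add: dist_norm)
  moreover have "H y t (u y t) (?p - fst (\<gamma> (y, t))) \<le> H y t (u y t) ?p + snd (\<gamma> (y, t))"
    using H_momentum[OF t, of y "u y t" ?p "?p - fst (\<gamma> (y, t))"] barrier[of y] by (simp add: dist_norm)
  ultimately have "H x t (W x t) ?p \<le> H y t (u y t) ?p"
    using residual by (simp add: doubled_residual_def)
  then have "l * (W x t - u y t) \<le> H y t (u y t) ?p - H x t (u y t) ?p"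
    using proper[OF order, of ?p] by linarith
  also have "\<dots> \<le> C * (\<beta> + norm ?p) * dist x y"
    using H_space[OF t, of x "u y t" ?p y] by (simp add: abs_le_iff)
  also have "\<dots> \<le> C * (2 * L) * dist x y"
    using L nonneg(1) by (intro mult_right_mono mult_left_mono) auto
  finally show ?thesis by (simp add: mult_ac)
qed

text \<open>Because the initial data are Lipschitz, the penalisation slope \<open>L\<close> stays fixed, so the same argument
  yields a Lipschitz estimate (for \<open>W = u\<close>) and a comparison principle (for \<open>xb = yb\<close>).\<close>

lemma proper_cone_comparison:
  assumes proper: "\<And>x t v w p. t \<in> {0..T} \<Longrightarrow> v \<le> w \<Longrightarrow> l * (w - v) \<le> H x t w p - H x t v p" and l: "2 * C < l"
    and sub: "subsolution T H W" and super: "supersolution T H u"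
    and W: "continuous_on (UNIV \<times> {0..<T}) (\<lambda>(x, t). W x t)"
    and u: "continuous_on (UNIV \<times> {0..<T}) (\<lambda>(x, t). u x t)"
    and t: "0 \<le> t" "t < T"
    and cone: "exp (A * t) * dist yb xb + (A * norm xb + B) * exp_primitive A t < R"
    and L: "0 < L" "\<beta> \<le> L"
    and init: "\<And>x y. x \<in> cball xb R \<Longrightarrow> y \<in> cball xb R \<Longrightarrow> W x 0 - u y 0 \<le> L * dist x y"
  shows "W xb t - u yb t \<le> L * dist xb yb"
proof (rule ccontr)
  assume contrary: "\<not> W xb t - u yb t \<le> L * dist xb yb"
  define \<sigma> where "\<sigma> = (W xb t - u yb t - L * dist xb yb) / 2"
  have \<sigma>: "0 < \<sigma>" using contrary by (simp add: \<sigma>_def)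
  obtain \<theta> :: "'a \<Rightarrow> real" and \<theta>' where \<theta>: "C1_on UNIV \<theta> \<theta>'" and \<theta>_ge: "\<And>d. L * norm d \<le> \<theta> d"
    and \<theta>_le: "\<And>d. \<theta> d \<le> L * norm d + \<sigma>" and \<theta>'_le: "\<And>d. norm (\<theta>' d) \<le> L"
    using C1_approximation_of_norm[OF L(1) \<sigma>] by blast
  define T1 where "T1 = (t + T) / 2"
  have T1: "t < T1" "T1 < T" using t by (auto simp: T1_def)
  obtain M where M: "0 \<le> M" "\<And>a b. a \<in> cball xb R \<times> {0..T1} \<Longrightarrow> b \<in> cball xb R \<times> {0..T1} \<Longrightarrow>
      W (fst a) (snd a) - u (fst b) (snd b) \<le> M"
    by (rule difference_bounded_above[OF W u compact_Times[OF compact_cball compact_Icc]]) (use T1 in auto)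
  obtain N \<Gamma> \<gamma> where N: "compact N" "N \<subseteq> cball xb R \<times> {0..T1}" "(xb, t) \<in> N" "(yb, t) \<in> N"
    and \<Gamma>: "C1_on UNIV \<Gamma> \<gamma>" "\<And>z. 0 \<le> \<Gamma> z" "\<Gamma> (xb, t) = 0" "\<Gamma> (yb, t) = 0"
    and speed: "\<And>x s. (A * norm x + B) * norm (fst (\<gamma> (x, s))) \<le> snd (\<gamma> (x, s))"
    and lateral: "\<And>z. z \<in> N \<Longrightarrow> 0 < snd z \<Longrightarrow> z \<in> interior N \<or> M \<le> \<Gamma> z"
    using cone_barrier[OF nonneg(3,4) t(1) T1(1) M(1) cone] by blast
  have "W xb t - u yb t = L * dist xb yb + 2 * \<sigma>" by (simp add: \<sigma>_def field_simps)
  then have base: "\<sigma> \<le> doubled_gap W u \<theta> \<Gamma> (xb, t) (yb, t)"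
    using \<theta>_le[of "xb - yb"] \<Gamma>(3,4) by (simp add: doubled_gap_def dist_norm)
  have inside: "0 < s \<and> (x, s) \<in> interior N \<and> (y, s) \<in> interior N"
    if "(x, s) \<in> N" "(y, s) \<in> N" "doubled_gap W u \<theta> \<Gamma> (xb, t) (yb, t) \<le> doubled_gap W u \<theta> \<Gamma> (x, s) (y, s)" for x y s
  proof (rule doubled_gap_pos_imp_interior[OF that(1,2) _ L(1) \<theta>_ge \<Gamma>(2)])
    show "0 < doubled_gap W u \<theta> \<Gamma> (x, s) (y, s)" using base \<sigma> that(3) by linarith
    have cylinder: "(x, s) \<in> cball xb R \<times> {0..T1}" "(y, s) \<in> cball xb R \<times> {0..T1}"
      using that(1,2) N(2) by blast+
    then show "0 \<le> s" "W x 0 - u y 0 \<le> L * norm (x - y)" using init[of x y] by (auto simp: dist_norm)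
    show "W x s - u y s \<le> M" using M(2)[OF cylinder] by simp
  qed (rule lateral)
  have "N \<subseteq> UNIV \<times> {0..<T}" using N(2) T1(2) by auto
  then obtain x y s where in_N: "(x, s) \<in> N"
    and le: "doubled_gap W u \<theta> \<Gamma> (xb, t) (yb, t) \<le> doubled_gap W u \<theta> \<Gamma> (x, s) (y, s)"
    and residual: "doubled_residual H W u \<theta>' \<gamma> (x, s) (y, s) \<le> 0"
    by (rule doubling_of_variables[OF sub super W u \<theta> \<Gamma>(1) N(1) _ N(3,4)]) (rule inside that; assumption)+
  have s: "s \<in> {0..T}" using in_N N(2) T1 by auto
  have "L * dist x y < W x s - u y s"
    using le base \<sigma> \<theta>_ge[of "x - y"] \<Gamma>(2)[of "(x, s)"] \<Gamma>(2)[of "(y, s)"] by (simp add: doubled_gap_def dist_norm)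
  moreover have "0 \<le> L * dist x y" using L(1) by simp
  ultimately have pos: "L * dist x y \<le> W x s - u y s" "0 < W x s - u y s" by auto
  then have "l * (W x s - u y s) \<le> 2 * C * (L * dist x y)"
    using doubled_residual_gap[where l = l, OF proper[OF s] s _ \<theta>'_le L(2) speed residual] by simp
  also have "\<dots> \<le> 2 * C * (W x s - u y s)" using pos(1) nonneg(1) by (intro mult_left_mono) auto
  finally show False using pos(2) l by simp
qed

lemma hamiltonian_discounted:
  assumes "0 \<le> l"
  shows "hamiltonian T (discounted l H) C \<beta> A B"
proof
  show "continuous_on (UNIV \<times> {0..T} \<times> UNIV \<times> UNIV) (\<lambda>(x, t, v, p). discounted l H x t v p)"
    unfolding discounted_def case_prod_unfold by (intro continuous_intros continuous_on_H) auto
  fix x y p q :: 'a and t v :: real assume t: "t \<in> {0..T}"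
  have "\<bar>H x t (exp (l * t) * v) (exp (l * t) *\<^sub>R p) - H y t (exp (l * t) * v) (exp (l * t) *\<^sub>R p)\<bar>
      \<le> C * (\<beta> + exp (l * t) * norm p) * dist x y"
    using H_space[OF t, of x "exp (l * t) * v" "exp (l * t) *\<^sub>R p" y] by simp
  also have "\<dots> \<le> C * (exp (l * t) * (\<beta> + norm p)) * dist x y"
    using nonneg assms t by (intro mult_right_mono mult_left_mono) (auto simp: distrib_left mult_le_cancel_right1)
  finally show "\<bar>discounted l H x t v p - discounted l H y t v p\<bar> \<le> C * (\<beta> + norm p) * dist x y"
    by (simp add: discounted_def divide_le_eq mult_ac flip: diff_divide_distrib)
  have "\<bar>H x t (exp (l * t) * v) (exp (l * t) *\<^sub>R p) - H x t (exp (l * t) * v) (exp (l * t) *\<^sub>R q)\<bar>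
      \<le> (A * norm x + B) * (exp (l * t) * dist p q)"
    using H_momentum[OF t, of x "exp (l * t) * v" "exp (l * t) *\<^sub>R p" "exp (l * t) *\<^sub>R q"]
    by (simp add: dist_norm flip: scaleR_diff_right)
  then show "\<bar>discounted l H x t v p - discounted l H x t v q\<bar> \<le> (A * norm x + B) * dist p q"
    by (simp add: discounted_def divide_le_eq mult_ac flip: diff_divide_distrib)
qed (use nonneg in auto)

end

locale lipschitz_hamiltonian = hamiltonian T H C \<beta> A B
  for T :: real and H :: "'a::euclidean_space \<Rightarrow> real \<Rightarrow> real \<Rightarrow> 'a \<Rightarrow> real" and C \<beta> A B +
  fixes K :: real
  assumes K_nonneg: "0 \<le> K"
    and H_value: "t \<in> {0..T} \<Longrightarrow> \<bar>H x t v p - H x t w p\<bar> \<le> K * \<bar>v - w\<bar>"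
begin

lemma discounted_proper:
  assumes t: "t \<in> {0..T}" and "v \<le> w"
  shows "(l - K) * (w - v) \<le> discounted l H x t w p - discounted l H x t v p"
proof -
  have "\<bar>exp (l * t) * v - exp (l * t) * w\<bar> = exp (l * t) * (w - v)"
    using \<open>v \<le> w\<close> by (simp add: abs_mult flip: right_diff_distrib)
  then have "H x t (exp (l * t) * v) (exp (l * t) *\<^sub>R p) - H x t (exp (l * t) * w) (exp (l * t) *\<^sub>R p)
      \<le> exp (l * t) * (K * (w - v))"
    using H_value[OF t, of x "exp (l * t) * v" "exp (l * t) *\<^sub>R p" "exp (l * t) * w"]
    by (simp add: abs_le_iff mult_ac)
  then have "(H x t (exp (l * t) * v) (exp (l * t) *\<^sub>R p)
      - H x t (exp (l * t) * w) (exp (l * t) *\<^sub>R p)) / exp (l * t)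
      \<le> K * (w - v)"
    by (simp add: divide_le_eq mult_ac)
  then show ?thesis by (simp add: discounted_def diff_divide_distrib algebra_simps)
qed

lemma cone_comparison:
  assumes sub: "subsolution T H W" and super: "supersolution T H u"
    and W: "continuous_on (UNIV \<times> {0..<T}) (\<lambda>(x, t). W x t)"
    and u: "continuous_on (UNIV \<times> {0..<T}) (\<lambda>(x, t). u x t)"
    and t: "0 \<le> t" "t < T"
    and cone: "exp (A * t) * dist y x + (A * norm x + B) * exp_primitive A t < R"
    and L: "0 < L" "\<beta> \<le> L"
    and init: "\<And>y z. y \<in> cball x R \<Longrightarrow> z \<in> cball x R \<Longrightarrow> W y 0 - u z 0 \<le> L * dist y z"
  shows "W x t - u y t \<le> exp ((K + 2 * C + 1) * t) * (L * dist x y)"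
proof -
  define l where "l = K + 2 * C + 1"
  have l: "0 \<le> l" "2 * C < l - K" using nonneg K_nonneg by (auto simp: l_def)
  interpret discounted: hamiltonian T "discounted l H" C \<beta> A B
    using l(1) by (rule hamiltonian_discounted)
  have "continuous_on (UNIV \<times> {0..<T}) (\<lambda>(x, t). w x t / exp (l * t))"
    if "continuous_on (UNIV \<times> {0..<T}) (\<lambda>(x, t). w x t)" for w :: "'a \<Rightarrow> real \<Rightarrow> real"
    using that unfolding case_prod_unfold by (intro continuous_intros) auto
  then have "W x t / exp (l * t) - u y t / exp (l * t) \<le> L * dist x y"
    using discounted.proper_cone_comparison[OF discounted_proper l(2) subsolution_discounted[OF sub]
        supersolution_discounted[OF super] _ _ t cone L] W u init by simp
  then show ?thesis by (simp add: l_def divide_le_eq mult.commute flip: diff_divide_distrib)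
qed

end

subsection \<open>Growth of subsolutions along lines\<close>

definition line_offset :: "'a::euclidean_space \<Rightarrow> real \<Rightarrow> 'a \<Rightarrow> 'a \<times> real \<Rightarrow> 'a" where
  "line_offset y0 t0 a z = fst z - (y0 + (snd z - t0) *\<^sub>R a)"

lemma continuous_on_line_offset [continuous_intros]:
  "continuous_on S f \<Longrightarrow> continuous_on S (\<lambda>z. line_offset y0 t0 a (f z))"
  unfolding line_offset_def by (intro continuous_intros)

lemma C1_on_line_offset_square:
  "C1_on S (\<lambda>z. line_offset y0 t0 a z \<bullet> line_offset y0 t0 a z)
    (\<lambda>z. (2 *\<^sub>R line_offset y0 t0 a z, - 2 * (line_offset y0 t0 a z \<bullet> a)))"
proof -
  have offset: "line_offset y0 t0 a z = fst z - snd z *\<^sub>R a + (t0 *\<^sub>R a - y0)" for z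
    by (simp add: line_offset_def algebra_simps)
  have "C1_on S (\<lambda>z. (fst z - snd z *\<^sub>R a + (t0 *\<^sub>R a - y0)) \<bullet> (fst z - snd z *\<^sub>R a + (t0 *\<^sub>R a - y0)))
    (\<lambda>z. (2 *\<^sub>R (fst z - snd z *\<^sub>R a + (t0 *\<^sub>R a - y0)), - (2 *\<^sub>R (fst z - snd z *\<^sub>R a + (t0 *\<^sub>R a - y0)) \<bullet> a)))"
  proof (rule C1_on_compose_affine[OF C1_on_inner_self])
    show "bounded_linear (\<lambda>z::'a \<times> real. fst z - snd z *\<^sub>R a)"
      by (intro bounded_linear_sub bounded_linear_fst
          bounded_linear_compose[OF bounded_linear_scaleR_left bounded_linear_snd])
    show "bounded_linear (\<lambda>x::'a. (x, - (x \<bullet> a)))"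
      by (intro bounded_linear_Pair bounded_linear_ident bounded_linear_minus bounded_linear_inner_left)
    show "(x, - (x \<bullet> a)) \<bullet> h = x \<bullet> (fst h - snd h *\<^sub>R a)" for x :: 'a and h
      by (simp add: inner_prod_def inner_diff_right)
  qed
  then show ?thesis by (simp add: offset)
qed

definition tube :: "'a::euclidean_space \<Rightarrow> real \<Rightarrow> 'a \<Rightarrow> real \<Rightarrow> real \<Rightarrow> ('a \<times> real) set" where
  "tube y0 t0 a t2 r = {z. snd z \<in> {t0..t2} \<and> norm (line_offset y0 t0 a z) \<le> r}"

lemma compact_tube: "compact (tube y0 t0 a t2 r)"
proof -
  have "tube y0 t0 a t2 r = (\<lambda>z. (y0 + (snd z - t0) *\<^sub>R a + fst z, snd z)) ` (cball 0 r \<times> {t0..t2})"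
  proof (intro equalityI subsetI)
    fix z assume "z \<in> tube y0 t0 a t2 r"
    then show "z \<in> (\<lambda>z. (y0 + (snd z - t0) *\<^sub>R a + fst z, snd z)) ` (cball 0 r \<times> {t0..t2})"
      by (intro image_eqI[of _ _ "(line_offset y0 t0 a z, snd z)"]) (auto simp: tube_def line_offset_def)
  qed (auto simp: tube_def line_offset_def)
  then show ?thesis
    by (auto intro!: compact_continuous_image compact_Times continuous_intros)
qed

lemma interior_tubeI:
  assumes "t0 < snd z" "snd z < t2" "norm (line_offset y0 t0 a z) < r"
  shows "z \<in> interior (tube y0 t0 a t2 r)"
proof (rule interiorI)
  show "open {z. t0 < snd z \<and> snd z < t2 \<and> norm (line_offset y0 t0 a z) < r}"
    by (intro open_Collect_conj open_Collect_less continuous_intros)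
qed (use assms in \<open>auto simp: tube_def\<close>)

lemma penalised_maximum_near_line:
  fixes f :: "'a::euclidean_space \<times> real \<Rightarrow> real"
  assumes f: "continuous_on (tube y0 t0 a t2 r) f" and "r > 0" and "t0 < t1" "t1 < t2"
    and ends: "f (y0, t0) < f (y0 + (t1 - t0) *\<^sub>R a, t1)"
      "f (y0 + (t2 - t0) *\<^sub>R a, t2) < f (y0 + (t1 - t0) *\<^sub>R a, t1)"
  obtains z k where "0 \<le> k" "z \<in> interior (tube y0 t0 a t2 r)" "t0 < snd z" "snd z < t2"
    "\<And>w. w \<in> tube y0 t0 a t2 r \<Longrightarrow> f w - k * (line_offset y0 t0 a w \<bullet> line_offset y0 t0 a w)
      \<le> f z - k * (line_offset y0 t0 a z \<bullet> line_offset y0 t0 a z)"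
proof -
  let ?N = "tube y0 t0 a t2 r" and ?q = "\<lambda>z. line_offset y0 t0 a z \<bullet> line_offset y0 t0 a z"
  have q: "continuous_on ?N ?q" by (intro continuous_intros)
  have on_line: "(y0 + (t1 - t0) *\<^sub>R a, t1) \<in> ?N" "?q (y0 + (t1 - t0) *\<^sub>R a, t1) = 0"
    using assms(2-4) by (auto simp: tube_def line_offset_def)
  obtain Z k z where k: "\<And>n. 0 \<le> k n" and Z_max: "\<And>n w. w \<in> ?N \<Longrightarrow> f w - k n * ?q w \<le> f (Z n) - k n * ?q (Z n)"
    and lim: "Z \<longlonglongrightarrow> z" and z: "z \<in> ?N" "?q z = 0" and z_max: "\<And>w. w \<in> ?N \<Longrightarrow> ?q w = 0 \<Longrightarrow> f w \<le> f z"
    by (rule penalised_maxima_converge[OF compact_tube f q inner_ge_zero on_line]) (rule that)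
  have z_eq: "z = (y0 + (snd z - t0) *\<^sub>R a, snd z)"
    using z(2) by (simp add: line_offset_def prod_eq_iff)
  then have "snd z \<noteq> t0" "snd z \<noteq> t2" using z_max[OF on_line] ends by auto
  define V where "V = {z. t0 < snd z \<and> snd z < t2 \<and> norm (line_offset y0 t0 a z) < r}"
  have "open V" unfolding V_def by (intro open_Collect_conj open_Collect_less continuous_intros)
  moreover have "z \<in> V"
    using z \<open>r > 0\<close> \<open>snd z \<noteq> t0\<close> \<open>snd z \<noteq> t2\<close> by (auto simp: V_def tube_def)
  ultimately obtain n where "Z n \<in> V"
    using topological_tendstoD[OF lim] eventually_happens by (metis sequentially_bot)
  then show thesis
    using k Z_max by (intro that[of "k n" "Z n"]) (auto simp: V_def interior_tubeI)
qed

lemma subsolution_at_penalised_maximum: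
  fixes u :: "'a::euclidean_space \<Rightarrow> real \<Rightarrow> real"
  assumes sub: "subsolution T H u" and lipschitz: "L-lipschitz_on UNIV (\<lambda>x. u x s)"
    and \<psi>: "C1_on UNIV \<psi> \<psi>'" and s: "0 < s" "s < T" and k: "0 \<le> k"
    and N: "(y, s) \<in> interior N" "(y0 + (s - t0) *\<^sub>R a, s) \<in> N"
    and max: "\<And>z. z \<in> N \<Longrightarrow>
      u (fst z) (snd z) - \<psi> (snd z) - k * (line_offset y0 t0 a z \<bullet> line_offset y0 t0 a z)
      \<le> u y s - \<psi> s - k * (line_offset y0 t0 a (y, s) \<bullet> line_offset y0 t0 a (y, s))"
  obtains q where "norm q \<le> 2 * L" "\<psi>' s - a \<bullet> q + H y s (u y s) q \<le> 0"
proof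
  let ?\<delta> = "line_offset y0 t0 a"
  let ?q = "(2 * k) *\<^sub>R ?\<delta> (y, s)"
  show "norm ?q \<le> 2 * L"
  proof (cases "?\<delta> (y, s) = 0")
    case True
    then show ?thesis using lipschitz_on_nonneg[OF lipschitz] by simp
  next
    case False
    have "k * (?\<delta> (y, s) \<bullet> ?\<delta> (y, s)) \<le> u y s - u (y0 + (s - t0) *\<^sub>R a) s"
      using max[OF N(2)] by (simp add: line_offset_def)
    also have "\<dots> \<le> L * norm (?\<delta> (y, s))"
      using lipschitz_onD[OF lipschitz, of y "y0 + (s - t0) *\<^sub>R a"]
      by (simp add: line_offset_def dist_norm abs_le_iff)
    finally have "(k * norm (?\<delta> (y, s))) * norm (?\<delta> (y, s)) \<le> L * norm (?\<delta> (y, s))"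
      by (simp add: dot_square_norm power2_eq_square)
    then show ?thesis using False k by simp
  qed
  have "C1_on UNIV (\<lambda>z. \<psi> (snd z) + k * (?\<delta> z \<bullet> ?\<delta> z))
      (\<lambda>z. (0, \<psi>' (snd z)) + k *\<^sub>R (2 *\<^sub>R ?\<delta> z, - 2 * (?\<delta> z \<bullet> a)))"
    by (intro C1_on_add C1_on_compose_snd[OF \<psi>] C1_on_cmult C1_on_line_offset_square)
  from subsolutionD[OF sub this s N(1)] max
  show "\<psi>' s - a \<bullet> ?q + H y s (u y s) ?q \<le> 0"
    by (fastforce simp: inner_commute algebra_simps)
qed

text \<open>An affine minorant \<open>a \<bullet> q - c\<close> of the Hamiltonian turns the equation into a transport inequality.
  Only slopes up to \<open>2 * L\<close> matter because \<open>u\<close> is \<open>L\<close>-Lipschitz in space.\<close>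

lemma subsolution_growth_along_line:
  fixes u :: "'a::euclidean_space \<Rightarrow> real \<Rightarrow> real"
  assumes sub: "subsolution T H u" and u: "continuous_on (UNIV \<times> {0..<T}) (\<lambda>(x, t). u x t)"
    and lipschitz: "\<And>t. 0 \<le> t \<Longrightarrow> t < T \<Longrightarrow> L-lipschitz_on UNIV (\<lambda>x. u x t)"
    and times: "0 \<le> t0" "t0 < t1" "t1 < t2" "t2 < T" and "r > 0"
    and minorant: "\<And>y s q. (y, s) \<in> tube y0 t0 a t2 r \<Longrightarrow> norm q \<le> 2 * L \<Longrightarrow> a \<bullet> q - c \<le> H y s (u y s) q"
  shows "u (y0 + (t1 - t0) *\<^sub>R a) t1 \<le> u y0 t0 + c * (t1 - t0)"
proof (rule ccontr)
  let ?u = "\<lambda>s. u (y0 + (s - t0) *\<^sub>R a) s"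
  assume "\<not> u (y0 + (t1 - t0) *\<^sub>R a) t1 \<le> u y0 t0 + c * (t1 - t0)"
  then have "c * (t1 - t0) < ?u t1 - ?u t0" by simp
  then obtain \<psi> \<psi>' where \<psi>: "C1_on UNIV \<psi> \<psi>'" and slope: "\<And>s. c < \<psi>' s"
    and ends: "?u t0 - \<psi> t0 < ?u t1 - \<psi> t1" "?u t2 - \<psi> t2 < ?u t1 - \<psi> t1"
    using strict_growth_test_function[OF times(2,3), of c ?u] by blast
  have "continuous_on (tube y0 t0 a t2 r) (\<lambda>z. u (fst z) (snd z) - \<psi> (snd z))"
    using times by (intro continuous_intros continuous_on_curried[OF u]
        continuous_on_compose2[OF C1_on_imp_continuous_on[OF \<psi>]]) (auto simp: tube_def)
  then obtain z k where k: "0 \<le> k" and z: "z \<in> interior (tube y0 t0 a t2 r)" "t0 < snd z" "snd z < t2"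
    and max: "\<And>w. w \<in> tube y0 t0 a t2 r \<Longrightarrow>
      u (fst w) (snd w) - \<psi> (snd w) - k * (line_offset y0 t0 a w \<bullet> line_offset y0 t0 a w)
      \<le> u (fst z) (snd z) - \<psi> (snd z) - k * (line_offset y0 t0 a z \<bullet> line_offset y0 t0 a z)"
    by (rule penalised_maximum_near_line[OF _ \<open>r > 0\<close> times(2,3)]) (use ends in auto)
  obtain y s where ys: "z = (y, s)" by (cases z)
  obtain q where "norm q \<le> 2 * L" "\<psi>' s - a \<bullet> q + H y s (u y s) q \<le> 0"
  proof (rule subsolution_at_penalised_maximum[OF sub lipschitz \<psi> _ _ k])
    show "(y0 + (s - t0) *\<^sub>R a, s) \<in> tube y0 t0 a t2 r"
      using z \<open>r > 0\<close> by (simp add: ys tube_def line_offset_def)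
  qed (use z times max in \<open>auto simp: ys\<close>)
  moreover have "(y, s) \<in> tube y0 t0 a t2 r" using z(1) interior_subset by (auto simp: ys)
  ultimately show False using minorant slope[of s] by fastforce
qed

subsection \<open>Minima over balls\<close>

lemma continuous_on_cINF_compact:
  fixes f :: "'a::topological_space \<Rightarrow> 'b::topological_space \<Rightarrow> real"
  assumes f: "continuous_on (U \<times> K) (\<lambda>(z, w). f z w)" and K: "compact K" "K \<noteq> {}"
  shows "continuous_on U (\<lambda>z. INF w\<in>K. f z w)"
proof -
  have attained: "\<exists>w\<in>K. (INF w\<in>K. f z w) = f z w \<and> (\<forall>w'\<in>K. (INF w\<in>K. f z w) \<le> f z w')" if "z \<in> U" for z
  proof -
    have "continuous_on K (\<lambda>w. (z, w))" by (intro continuous_intros)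
    then have "continuous_on K (f z)" using continuous_on_compose2[OF f] that by fastforce
    then obtain w where "w \<in> K" "\<And>w'. w' \<in> K \<Longrightarrow> f z w \<le> f z w'"
      using continuous_attains_inf[OF K] by blast
    moreover from this have "(INF w\<in>K. f z w) = f z w" by (intro cInf_eq_minimum) auto
    ultimately show ?thesis by auto
  qed
  show ?thesis
    unfolding continuous_on_def
  proof (intro ballI tendstoI)
    fix z and e :: real assume z: "z \<in> U" and "e > 0"
    obtain V where V: "z \<in> V" "open V" "\<forall>y\<in>V \<inter> U. \<forall>w\<in>K. dist (f y w) (f z w) \<le> e / 2"
      by (rule continuous_on_prod_compactE[OF f K(1) z half_gt_zero[OF \<open>e > 0\<close>]]) (rule that; simp)
    have "dist (INF w\<in>K. f y w) (INF w\<in>K. f z w) < e" if y: "y \<in> V" "y \<in> U" for y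
    proof -
      obtain w where w: "w \<in> K" "(INF w\<in>K. f y w) = f y w" "\<forall>w'\<in>K. (INF w\<in>K. f y w) \<le> f y w'"
        using attained[OF y(2)] by blast
      obtain w' where w': "w' \<in> K" "(INF w\<in>K. f z w) = f z w'" "\<forall>w\<in>K. (INF w\<in>K. f z w) \<le> f z w"
        using attained[OF z] by blast
      have "\<bar>f y w - f z w\<bar> \<le> e / 2" "\<bar>f y w' - f z w'\<bar> \<le> e / 2"
        using V(3) y w(1) w'(1) by (auto simp: dist_real_def)
      then have "\<bar>(INF w\<in>K. f y w) - (INF w\<in>K. f z w)\<bar> \<le> e / 2"
        using w(2) w'(2) bspec[OF w(3) w'(1)] bspec[OF w'(3) w(1)] by linarith
      then show ?thesis using \<open>e > 0\<close> by (simp add: dist_real_def)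
    qed
    then show "\<forall>\<^sub>F y in at z within U. dist (INF w\<in>K. f y w) (INF w\<in>K. f z w) < e"
      using V(1,2) by (auto simp: eventually_at_topological)
  qed
qed

definition ball_min :: "('a::metric_space \<Rightarrow> real) \<Rightarrow> real \<Rightarrow> 'a \<Rightarrow> real" where
  "ball_min f r x = (INF y\<in>cball x r. f y)"

lemma ball_min_attained:
  fixes f :: "'a::euclidean_space \<Rightarrow> real"
  assumes "continuous_on UNIV f" "0 \<le> r"
  obtains y where "y \<in> cball x r" "ball_min f r x = f y" "\<And>z. z \<in> cball x r \<Longrightarrow> f y \<le> f z"
proof -
  obtain y where y: "y \<in> cball x r" "\<And>z. z \<in> cball x r \<Longrightarrow> f y \<le> f z"
    using continuous_attains_inf[OF compact_cball _ continuous_on_subset[OF assms(1)], of x r] assms(2) by auto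
  then have "ball_min f r x = f y" unfolding ball_min_def by (intro cInf_eq_minimum) auto
  then show thesis using y that by blast
qed

lemma ball_min_le:
  fixes f :: "'a::euclidean_space \<Rightarrow> real"
  assumes "continuous_on UNIV f" "y \<in> cball x r"
  shows "ball_min f r x \<le> f y"
proof -
  have "dist x y \<le> r" using assms(2) by simp
  then have "0 \<le> r" using zero_le_dist[of x y] by linarith
  then show ?thesis using ball_min_attained[OF assms(1), of r x] assms(2) by metis
qed

lemma ball_min_eq_INF_unit_ball:
  fixes f :: "'a::real_normed_vector \<Rightarrow> real"
  assumes "0 < r"
  shows "ball_min f r x = (INF w\<in>cball 0 1. f (x + r *\<^sub>R w))"
proof -
  have "cball (0::'a) r = (\<lambda>w. r *\<^sub>R w) ` cball 0 1" using cball_scale[of r "0::'a" 1] assms by simp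
  then have "cball x r = (\<lambda>w. x + r *\<^sub>R w) ` cball 0 1"
    using cball_translation[of x 0 r] by (simp only: image_image add_0_right)
  then show ?thesis by (simp add: ball_min_def image_image)
qed

lemma continuous_on_ball_min:
  fixes u :: "'a::euclidean_space \<Rightarrow> real \<Rightarrow> real"
  assumes u: "continuous_on (UNIV \<times> I) (\<lambda>(x, t). u x t)"
    and \<rho>: "continuous_on I \<rho>" "\<And>t. t \<in> I \<Longrightarrow> 0 < \<rho> t"
  shows "continuous_on (UNIV \<times> I) (\<lambda>(x, t). ball_min (\<lambda>y. u y t) (\<rho> t) x)"
proof -
  have "continuous_on (UNIV \<times> I) (\<lambda>z. INF w\<in>cball 0 1. u (fst z + \<rho> (snd z) *\<^sub>R w) (snd z))"
    unfolding case_prod_unfold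
    by (intro continuous_on_cINF_compact)
      (auto simp: case_prod_unfold intro!: continuous_on_curried[OF u] continuous_intros
          continuous_on_compose2[OF \<rho>(1)])
  moreover have "(INF w\<in>cball 0 1. u (fst z + \<rho> (snd z) *\<^sub>R w) (snd z))
      = (case z of (x, t) \<Rightarrow> ball_min (\<lambda>y. u y t) (\<rho> t) x)"
    if "z \<in> UNIV \<times> I" for z
    using that \<rho>(2) by (auto simp: ball_min_eq_INF_unit_ball)
  ultimately show ?thesis by (metis (no_types, lifting) continuous_on_cong)
qed

lemma ball_min_minimisers_converge:
  fixes u :: "'a::euclidean_space \<Rightarrow> real \<Rightarrow> real"
  assumes u: "continuous_on (UNIV \<times> I) (\<lambda>(x, t). u x t)"
    and \<rho>: "continuous_on I \<rho>" "\<And>t. t \<in> I \<Longrightarrow> 0 < \<rho> t"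
    and X: "X \<longlonglongrightarrow> x" and \<tau>: "\<tau> \<longlonglongrightarrow> t" "\<And>n. \<tau> n \<in> I" "t \<in> I"
  obtains r Y y where "strict_mono r" "Y \<longlonglongrightarrow> y" "y \<in> cball x (\<rho> t)" "ball_min (\<lambda>y. u y t) (\<rho> t) x = u y t"
    "\<And>n. Y n \<in> cball (X (r n)) (\<rho> (\<tau> (r n)))"
    "\<And>n. ball_min (\<lambda>y. u y (\<tau> (r n))) (\<rho> (\<tau> (r n))) (X (r n)) = u (Y n) (\<tau> (r n))"
proof -
  have "\<exists>w. norm w \<le> 1 \<and> ball_min (\<lambda>y. u y (\<tau> n)) (\<rho> (\<tau> n)) (X n) = u (X n + \<rho> (\<tau> n) *\<^sub>R w) (\<tau> n)" for n
  proof -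
    have "continuous_on UNIV (\<lambda>y. u y (\<tau> n))" using \<tau>(2) by (intro continuous_on_curried[OF u] continuous_intros)
    then obtain y where y: "y \<in> cball (X n) (\<rho> (\<tau> n))" "ball_min (\<lambda>y. u y (\<tau> n)) (\<rho> (\<tau> n)) (X n) = u y (\<tau> n)"
      using ball_min_attained[of "\<lambda>y. u y (\<tau> n)" "\<rho> (\<tau> n)" "X n"] \<rho>(2)[OF \<tau>(2)] by (metis less_imp_le)
    then show ?thesis
      using \<rho>(2)[OF \<tau>(2), of n]
      by (intro exI[of _ "(1 / \<rho> (\<tau> n)) *\<^sub>R (y - X n)"]) (auto simp: dist_norm norm_minus_commute divide_le_eq)
  qed
  then obtain w where w: "\<And>n. w n \<in> cball 0 1"
    "\<And>n. ball_min (\<lambda>y. u y (\<tau> n)) (\<rho> (\<tau> n)) (X n) = u (X n + \<rho> (\<tau> n) *\<^sub>R w n) (\<tau> n)"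
    by (auto simp: dist_norm) metis
  obtain v r where v: "v \<in> cball 0 1" and r: "strict_mono r" and w_lim: "(w \<circ> r) \<longlonglongrightarrow> v"
    using compact_cball w(1) unfolding compact_def by metis
  note subseq = LIMSEQ_subseq_LIMSEQ[OF _ r, unfolded o_def]
  define Y where "Y n = X (r n) + \<rho> (\<tau> (r n)) *\<^sub>R w (r n)" for n
  have "(\<lambda>n. \<rho> (\<tau> (r n))) \<longlonglongrightarrow> \<rho> t"
    using continuous_on_tendsto_compose[OF \<rho>(1) subseq[OF \<tau>(1)] \<tau>(3)] \<tau>(2) by simp
  then have Y: "Y \<longlonglongrightarrow> x + \<rho> t *\<^sub>R v"
    unfolding Y_def[abs_def] using w_lim by (intro tendsto_intros subseq[OF X]) (simp_all add: o_def)
  have "(\<lambda>n. ball_min (\<lambda>y. u y (\<tau> (r n))) (\<rho> (\<tau> (r n))) (X (r n))) \<longlonglongrightarrow> ball_min (\<lambda>y. u y t) (\<rho> t) x"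
    using continuous_on_tendsto_compose[OF continuous_on_ball_min[OF u \<rho>]
        tendsto_Pair[OF subseq[OF X] subseq[OF \<tau>(1)]]] \<tau>
    by simp
  moreover have "(\<lambda>n. u (Y n) (\<tau> (r n))) \<longlonglongrightarrow> u (x + \<rho> t *\<^sub>R v) t"
    using continuous_on_tendsto_compose[OF u tendsto_Pair[OF Y subseq[OF \<tau>(1)]]] \<tau> by simp
  ultimately have "ball_min (\<lambda>y. u y t) (\<rho> t) x = u (x + \<rho> t *\<^sub>R v) t"
    by (simp add: w(2) flip: Y_def) (metis LIMSEQ_unique)
  moreover have "x + \<rho> t' *\<^sub>R w' \<in> cball x (\<rho> t')" if "t' \<in> I" "w' \<in> cball 0 1" for x w' :: 'a and t'
    using that \<rho>(2)[OF that(1)] by (simp add: dist_norm mult_left_le)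
  ultimately show thesis
    using r Y v w \<tau> by (intro that[of r Y "x + \<rho> t *\<^sub>R v"]) (auto simp: Y_def)
qed

subsection \<open>Minima over growing balls are subsolutions\<close>

lemma frequently_filterlim: "\<exists>\<^sub>F n in G. P (g n) \<Longrightarrow> filterlim g F G \<Longrightarrow> \<exists>\<^sub>F x in F. P x"
  unfolding frequently_def using eventually_compose_filterlim by blast

lemma eventually_at_right_decrement:
  fixes f :: "real \<Rightarrow> real"
  assumes "(f has_real_derivative f') (at t)" "c < f'"
  shows "\<forall>\<^sub>F h in at_right 0. f (t - h) + c * h < f t"
proof -
  have "((\<lambda>s. f s - c * s) has_real_derivative f' - c) (at t)"
    by (auto intro!: derivative_eq_intros assms(1))
  from DERIV_pos_inc_left[OF this] obtain d where "d > 0"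
    "\<And>h. 0 < h \<Longrightarrow> h < d \<Longrightarrow> f (t - h) - c * (t - h) < f t - c * t"
    using assms(2) by auto
  then show ?thesis
    unfolding eventually_at_right_field by (intro exI[of _ d]) (auto simp: algebra_simps)
qed

lemma C1_on_imp_DERIV_along_line:
  assumes "C1_on UNIV \<phi> g"
  shows "((\<lambda>s. \<phi> (x + (s - t) *\<^sub>R a, s)) has_real_derivative fst (g (x, t)) \<bullet> a + snd (g (x, t))) (at t)"
proof -
  have "((\<lambda>s. (x + (s - t) *\<^sub>R a, s)) has_derivative (\<lambda>s. (s *\<^sub>R a, s))) (at t)"
    by (auto intro!: derivative_eq_intros)
  moreover have "(\<phi> has_derivative (\<lambda>h. g (x, t) \<bullet> h)) (at (x + (t - t) *\<^sub>R a, t))"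
    using assms by (auto simp: C1_on_def)
  ultimately have "((\<lambda>s. \<phi> (x + (s - t) *\<^sub>R a, s)) has_derivative (\<lambda>s. g (x, t) \<bullet> (s *\<^sub>R a, s))) (at t)"
    by (rule has_derivative_compose)
  then show ?thesis
    unfolding has_field_derivative_def
    by (rule has_derivative_eq_rhs) (auto simp: fun_eq_iff inner_prod_def algebra_simps)
qed

lemma test_function_slope_le_of_backward_growth:
  fixes M :: "'a::euclidean_space \<Rightarrow> real \<Rightarrow> real"
  assumes \<phi>: "C1_on UNIV \<phi> g" and N: "(x, t) \<in> interior N"
    and max: "\<And>y s. (y, s) \<in> N \<Longrightarrow> M y s - \<phi> (y, s) \<le> M x t - \<phi> (x, t)"
    and growth: "\<exists>\<^sub>F h in at_right 0. M x t \<le> M (x - h *\<^sub>R a) (t - h) + c * h"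
  shows "fst (g (x, t)) \<bullet> a + snd (g (x, t)) \<le> c"
proof (rule ccontr)
  assume "\<not> fst (g (x, t)) \<bullet> a + snd (g (x, t)) \<le> c"
  then have "c < fst (g (x, t)) \<bullet> a + snd (g (x, t))" by simp
  from eventually_at_right_decrement[OF C1_on_imp_DERIV_along_line[OF \<phi>] this]
  have "\<forall>\<^sub>F h in at_right 0. \<phi> (x - h *\<^sub>R a, t - h) + c * h < \<phi> (x, t)" by simp
  moreover have "((\<lambda>h. (x - h *\<^sub>R a, t - h)) \<longlongrightarrow> (x - 0 *\<^sub>R a, t - 0)) (at_right 0)" by (intro tendsto_intros)
  then have "\<forall>\<^sub>F h in at_right 0. (x - h *\<^sub>R a, t - h) \<in> interior N"
    using topological_tendstoD[OF _ open_interior] N by fastforce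
  ultimately have "\<forall>\<^sub>F h in at_right 0. \<phi> (x - h *\<^sub>R a, t - h) + c * h < \<phi> (x, t) \<and> (x - h *\<^sub>R a, t - h) \<in> N"
    by eventually_elim (use interior_subset in blast)
  then obtain h where h: "\<phi> (x - h *\<^sub>R a, t - h) + c * h < \<phi> (x, t)" "(x - h *\<^sub>R a, t - h) \<in> N"
    and "M x t \<le> M (x - h *\<^sub>R a) (t - h) + c * h"
    using frequently_ex[OF frequently_eventually_conj[OF growth]] by blast
  then show False using max[OF h(2)] by linarith
qed

lemma line_step_in_cball:
  fixes x y a b :: "'a::real_normed_vector"
  assumes "y \<in> cball (x - h *\<^sub>R a) r" "norm (b - a) \<le> c" "0 \<le> h" "r + h * c \<le> r'"
  shows "y + h *\<^sub>R b \<in> cball x r'"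
proof -
  have split: "x - (y + h *\<^sub>R b) = (x - h *\<^sub>R a - y) - h *\<^sub>R (b - a)" by (simp add: algebra_simps)
  have "dist x (y + h *\<^sub>R b) \<le> dist (x - h *\<^sub>R a) y + h * norm (b - a)"
    using norm_triangle_ineq4[of "x - h *\<^sub>R a - y" "h *\<^sub>R (b - a)"] assms(3)
    unfolding dist_norm split by simp
  also have "\<dots> \<le> r + h * c" using assms by (intro add_mono mult_left_mono) auto
  finally show ?thesis using assms(4) by simp
qed

context hamiltonian
begin

lemma affine_minorant_nearby:
  assumes u: "continuous_on (UNIV \<times> {0..<T}) (\<lambda>(x, t). u x t)" and t: "0 \<le> t" "t < T"
    and minorant: "\<And>q. b \<bullet> q - c \<le> H y t (u y t) q" and "c < c'"
  obtains e where "e > 0" "\<And>z s q. 0 \<le> s \<Longrightarrow> s < T \<Longrightarrow> dist (z, s) (y, t) < e \<Longrightarrow> norm q \<le> R \<Longrightarrow>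
    b \<bullet> q - c' \<le> H z s (u z s) q"
proof -
  let ?U = "(UNIV :: 'a set) \<times> {0..<T}"
  let ?f = "\<lambda>z. H (fst (fst z)) (snd (fst z)) (u (fst (fst z)) (snd (fst z))) (snd z)"
  have "continuous_on (?U \<times> cball 0 R) ?f"
    by (intro continuous_on_H continuous_on_curried[OF u] continuous_intros) auto
  then obtain V where V: "(y, t) \<in> V" "open V"
    and close: "\<forall>z\<in>V \<inter> ?U. \<forall>q\<in>cball 0 R. dist (?f (z, q)) (?f ((y, t), q)) \<le> c' - c"
    using continuous_on_prod_compactE[OF _ compact_cball, of ?U 0 R ?f "(y, t)" "c' - c"] t \<open>c < c'\<close> by auto
  obtain e where e: "e > 0" "ball (y, t) e \<subseteq> V" using V by (meson openE)
  have "b \<bullet> q - c' \<le> H z s (u z s) q" if z: "0 \<le> s" "s < T" "dist (z, s) (y, t) < e" and q: "norm q \<le> R" for z s q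
  proof -
    have "(z, s) \<in> V \<inter> ?U" "q \<in> cball 0 R" using z q e(2) by (auto simp: dist_commute subset_iff)
    then have "dist (?f ((z, s), q)) (?f ((y, t), q)) \<le> c' - c" using close by blast
    then show ?thesis using minorant[of q] by (simp add: dist_real_def abs_le_iff)
  qed
  then show thesis using e(1) that by blast
qed

lemma subsolution_local_growth:
  assumes sub: "subsolution T H u" and u: "continuous_on (UNIV \<times> {0..<T}) (\<lambda>(x, t). u x t)"
    and lipschitz: "\<And>t. 0 \<le> t \<Longrightarrow> t < T \<Longrightarrow> L-lipschitz_on UNIV (\<lambda>x. u x t)"
    and t: "0 < t" "t < T" and minorant: "\<And>q. b \<bullet> q - c \<le> H y t (u y t) q" and "c < c'"
  obtains d where "d > 0" "\<And>z h. dist z y < d \<Longrightarrow> 0 < h \<Longrightarrow> h < d \<Longrightarrow> u (z + h *\<^sub>R b) t \<le> u z (t - h) + c' * h"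
proof -
  obtain e where "e > 0" and nearby: "\<And>z s q. 0 \<le> s \<Longrightarrow> s < T \<Longrightarrow> dist (z, s) (y, t) < e \<Longrightarrow> norm q \<le> 2 * L \<Longrightarrow>
      b \<bullet> q - c' \<le> H z s (u z s) q"
    using affine_minorant_nearby[OF u less_imp_le[OF t(1)] t(2) minorant \<open>c < c'\<close>] by metis
  define d where "d = min (e / (4 * (norm b + 1))) (min t ((T - t) / 2))"
  have "norm b + 1 > 0" by (simp add: add_nonneg_pos)
  then have "d > 0" using \<open>e > 0\<close> t by (simp add: d_def)
  have "d \<le> min t ((T - t) / 2)" unfolding d_def by (rule min.cobounded2)
  then have d: "d \<le> t" "t + d < T" using t by (auto simp: field_simps)
  have "d * (norm b + 1) \<le> e / (4 * (norm b + 1)) * (norm b + 1)"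
    by (intro mult_right_mono) (auto simp: d_def)
  also have "\<dots> = e / 4"
    using \<open>norm b + 1 > 0\<close> by (metis divide_divide_eq_left less_irrefl nonzero_eq_divide_eq)
  finally have d_small: "d * norm b + d \<le> e / 4" by (simp add: distrib_left)
  have "u (z + h *\<^sub>R b) t \<le> u z (t - h) + c' * h" if z: "dist z y < d" and h: "0 < h" "h < d" for z h
  proof -
    have "u (z + (t - (t - h)) *\<^sub>R b) t \<le> u z (t - h) + c' * (t - (t - h))"
    proof (rule subsolution_growth_along_line[OF sub u lipschitz, where r = "e / 4"])
      fix w s and q :: 'a
      assume w: "(w, s) \<in> tube z (t - h) b (t + d) (e / 4)" and q: "norm q \<le> 2 * L"
      let ?x = "z + (s - (t - h)) *\<^sub>R b"
      have s: "t - h \<le> s" "s \<le> t + d" and "norm (w - ?x) \<le> e / 4" using w by (auto simp: tube_def line_offset_def)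
      have "dist ?x z = (s - (t - h)) * norm b" using s by (simp add: dist_norm)
      also have "\<dots> \<le> (2 * d) * norm b" using s h by (intro mult_right_mono) auto
      finally have "dist ?x z \<le> 2 * (d * norm b)" by simp
      moreover have "dist w y \<le> norm (w - ?x) + dist ?x z + dist z y"
        using dist_triangle[of w y ?x] dist_triangle[of ?x y z] by (simp add: dist_norm)
      moreover have "dist s t \<le> d" using s h by (simp add: dist_real_def)
      moreover have "dist (w, s) (y, t) \<le> dist w y + dist s t"
        unfolding dist_prod_def using sqrt_sum_squares_le_sum[of "dist w y" "dist s t"] by simp
      ultimately have "dist (w, s) (y, t) < e"
        using \<open>norm (w - ?x) \<le> e / 4\<close> z d_small \<open>e > 0\<close> by linarith
      then show "b \<bullet> q - c' \<le> H w s (u w s) q" using s h d q by (intro nearby) auto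
    qed (use h d \<open>d > 0\<close> \<open>e > 0\<close> in auto)
    then show ?thesis by simp
  qed
  then show thesis using \<open>d > 0\<close> that by blast
qed

end

locale convex_hamiltonian = lipschitz_hamiltonian T H C \<beta> A B K
  for T :: real and H :: "'a::euclidean_space \<Rightarrow> real \<Rightarrow> real \<Rightarrow> 'a \<Rightarrow> real" and C \<beta> A B K +
  assumes H_convex: "t \<in> {0..T} \<Longrightarrow> convex_on UNIV (\<lambda>p. H x t v p)"
begin

text \<open>Between two points at distance at most \<open>r\<close>, (H1) only turns an affine minorant of slope \<open>a\<close> into an
  affine function minus \<open>C * r * norm q\<close>; convexity replaces it by an affine minorant of a nearby slope \<open>b\<close>.\<close>

lemma affine_minorant_transfer:
  assumes t: "t \<in> {0..T}" and "dist x y \<le> r" and subgradient: "\<And>q. H x t v p + a \<bullet> (q - p) \<le> H x t v q"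
  obtains b where "norm (b - a) \<le> C * r"
    "\<And>q. b \<bullet> q - (C * \<beta> * r + K * \<bar>v - w\<bar> + a \<bullet> p - H x t v p) \<le> H y t w q"
proof -
  define c where "c = H x t v p - a \<bullet> p - C * \<beta> * r - K * \<bar>v - w\<bar>"
  have "0 \<le> r" using \<open>dist x y \<le> r\<close> zero_le_dist[of x y] by linarith
  have "c + a \<bullet> q - C * r * norm q \<le> H y t w q" for q
  proof -
    have "C * (\<beta> + norm q) * dist x y \<le> C * (\<beta> + norm q) * r"
      using \<open>dist x y \<le> r\<close> nonneg by (intro mult_left_mono) auto
    then have "H x t v q - C * (\<beta> + norm q) * r - K * \<bar>v - w\<bar> \<le> H y t w q"
      using H_space[OF t, of x v q y] H_value[OF t, of y v q w] by linarith
    then show ?thesis using subgradient[of q] by (simp add: c_def algebra_simps)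
  qed
  then obtain b where "norm (b - a) \<le> C * r" "\<And>q. c + b \<bullet> q \<le> H y t w q"
    using convex_affine_minorant_above_cone[OF H_convex[OF t]] nonneg(1) \<open>0 \<le> r\<close> by (metis mult_nonneg_nonneg)
  then show thesis by (intro that) (auto simp: c_def algebra_simps)
qed

lemma ball_min_growth:
  assumes sub: "subsolution T H u" and u: "continuous_on (UNIV \<times> {0..<T}) (\<lambda>(x, t). u x t)"
    and lipschitz: "\<And>t. 0 \<le> t \<Longrightarrow> t < T \<Longrightarrow> L-lipschitz_on UNIV (\<lambda>x. u x t)"
    and t: "0 < t" "t < T"
    and \<rho>: "\<And>s. 0 < \<rho> s" "continuous_on UNIV \<rho>" "(\<rho> has_real_derivative \<rho>') (at t)" "C * \<rho> t < \<rho>'"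
    and subgradient: "\<And>q. H x t v p + a \<bullet> (q - p) \<le> H x t v q"
    and c: "C * \<beta> * \<rho> t + K * \<bar>v - ball_min (\<lambda>y. u y t) (\<rho> t) x\<bar> + a \<bullet> p - H x t v p < c"
  shows "\<exists>\<^sub>F h in at_right 0. ball_min (\<lambda>y. u y t) (\<rho> t) x
    \<le> ball_min (\<lambda>y. u y (t - h)) (\<rho> (t - h)) (x - h *\<^sub>R a) + c * h"
proof -
  define h where "h n = t * inverse (real (Suc n))" for n
  have h_pos: "0 < h n" and h_le: "h n \<le> t" for n using t by (auto simp: h_def field_simps)
  have h_lim: "h \<longlonglongrightarrow> 0"
    unfolding h_def[abs_def] by (rule tendsto_mult_right_zero[OF LIMSEQ_inverse_real_of_nat])
  have X: "(\<lambda>n. x - h n *\<^sub>R a) \<longlonglongrightarrow> x" and \<tau>: "(\<lambda>n. t - h n) \<longlonglongrightarrow> t"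
    using h_lim by (auto intro!: tendsto_eq_intros)
  have slab: "t - h n \<in> {0..<T}" "t \<in> {0..<T}" for n using h_pos[of n] h_le[of n] t by auto
  obtain r Y y where r: "strict_mono r" and Y: "Y \<longlonglongrightarrow> y" and y: "y \<in> cball x (\<rho> t)"
    and y_min: "ball_min (\<lambda>y. u y t) (\<rho> t) x = u y t"
    and Y_ball: "\<And>n. Y n \<in> cball (x - h (r n) *\<^sub>R a) (\<rho> (t - h (r n)))"
    and Y_min: "\<And>n. ball_min (\<lambda>y. u y (t - h (r n))) (\<rho> (t - h (r n))) (x - h (r n) *\<^sub>R a) = u (Y n) (t - h (r n))"
    by (rule ball_min_minimisers_converge[OF u continuous_on_subset[OF \<rho>(2) subset_UNIV] \<rho>(1) X \<tau> slab])
      (rule that)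
  have "t \<in> {0..T}" using t by simp
  then obtain b where b: "norm (b - a) \<le> C * \<rho> t"
    and minorant: "\<And>q. b \<bullet> q - (C * \<beta> * \<rho> t + K * \<bar>v - u y t\<bar> + a \<bullet> p - H x t v p) \<le> H y t (u y t) q"
    using affine_minorant_transfer[OF _ _ subgradient, of y "\<rho> t" "u y t"] y by auto
  obtain d where "d > 0"
    and growth: "\<And>z h. dist z y < d \<Longrightarrow> 0 < h \<Longrightarrow> h < d \<Longrightarrow> u (z + h *\<^sub>R b) t \<le> u z (t - h) + c * h"
    using subsolution_local_growth[OF sub u lipschitz t minorant] c unfolding y_min by blast
  have h_sub: "(\<lambda>n. h (r n)) \<longlonglongrightarrow> 0" using LIMSEQ_subseq_LIMSEQ[OF h_lim r] by (simp add: o_def)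
  then have at_right: "filterlim (\<lambda>n. h (r n)) (at_right 0) sequentially"
    using h_pos by (auto simp: filterlim_at less_imp_neq[symmetric])
  from eventually_compose_filterlim[OF eventually_at_right_decrement[OF \<rho>(3,4)] this]
  have "\<forall>\<^sub>F n in sequentially. \<rho> (t - h (r n)) + C * \<rho> t * h (r n) < \<rho> t" .
  moreover have "\<forall>\<^sub>F n in sequentially. dist (Y n) y < d" using tendstoD[OF Y \<open>d > 0\<close>] .
  moreover have "\<forall>\<^sub>F n in sequentially. h (r n) < d" using order_tendstoD(2)[OF h_sub \<open>d > 0\<close>] .
  ultimately have "\<forall>\<^sub>F n in sequentially. ball_min (\<lambda>y. u y t) (\<rho> t) x
    \<le> ball_min (\<lambda>y. u y (t - h (r n))) (\<rho> (t - h (r n))) (x - h (r n) *\<^sub>R a) + c * h (r n)"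
  proof eventually_elim
    case (elim n)
    have "Y n + h (r n) *\<^sub>R b \<in> cball x (\<rho> t)"
      using elim(1) h_pos[of "r n"] by (intro line_step_in_cball[OF Y_ball b]) (auto simp: mult_ac)
    then have "ball_min (\<lambda>y. u y t) (\<rho> t) x \<le> u (Y n + h (r n) *\<^sub>R b) t"
      using t by (intro ball_min_le continuous_on_curried[OF u] continuous_intros) auto
    also have "\<dots> \<le> u (Y n) (t - h (r n)) + c * h (r n)" using elim h_pos by (intro growth) auto
    finally show ?case by (simp add: Y_min)
  qed
  then show ?thesis by (intro frequently_filterlim[OF _ at_right] eventually_frequently sequentially_bot)
qed

lemma subsolution_ball_min:
  assumes sub: "subsolution T H u" and u: "continuous_on (UNIV \<times> {0..<T}) (\<lambda>(x, t). u x t)"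
    and lipschitz: "\<And>t. 0 \<le> t \<Longrightarrow> t < T \<Longrightarrow> L-lipschitz_on UNIV (\<lambda>x. u x t)"
    and \<rho>: "\<And>t. 0 < \<rho> t" "\<And>t. (\<rho> has_real_derivative \<rho>' t) (at t)" "\<And>t. C * \<rho> t < \<rho>' t"
    and m: "C1_on UNIV m m'" "\<And>t. 0 < t \<Longrightarrow> t < T \<Longrightarrow> 0 \<le> m t"
      "\<And>t. 0 < t \<Longrightarrow> t < T \<Longrightarrow> m' t + K * m t + C * \<beta> * \<rho> t \<le> 0"
  shows "subsolution T H (\<lambda>x t. ball_min (\<lambda>y. u y t) (\<rho> t) x + m t)"
proof (rule subsolutionI)
  fix \<phi> g N and x :: 'a and t :: real
  let ?B = "\<lambda>x t. ball_min (\<lambda>y. u y t) (\<rho> t) x"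
  let ?v = "?B x t + m t"
  assume \<phi>: "C1_on UNIV \<phi> g" and t: "0 < t" "t < T" and N: "(x, t) \<in> interior N"
    and max: "\<And>y s. (y, s) \<in> N \<Longrightarrow> ?B y s + m s - \<phi> (y, s) \<le> ?v - \<phi> (x, t)"
  let ?p = "fst (g (x, t))"
  have "t \<in> {0..T}" using t by simp
  then obtain a where subgradient: "\<And>q. H x t ?v ?p + a \<bullet> (q - ?p) \<le> H x t ?v q"
    using convex_subgradient[OF H_convex] by metis
  have \<rho>_cont: "continuous_on UNIV \<rho>" using \<rho>(2) by (meson DERIV_continuous continuous_at_imp_continuous_on)
  have "C1_on UNIV (\<lambda>z. \<phi> z + - m (snd z)) (\<lambda>z. g z + - (0, m' (snd z)))"
    by (intro C1_on_add C1_on_uminus C1_on_compose_snd \<phi> m(1))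
  note slope_le = test_function_slope_le_of_backward_growth[OF this N, where M = ?B and a = a]
  have "?p \<bullet> a + (snd (g (x, t)) - m' t) \<le> C * \<beta> * \<rho> t + K * m t + a \<bullet> ?p - H x t ?v ?p"
  proof (rule dense_ge)
    fix c assume "C * \<beta> * \<rho> t + K * m t + a \<bullet> ?p - H x t ?v ?p < c"
    then have "\<exists>\<^sub>F h in at_right 0. ?B x t \<le> ?B (x - h *\<^sub>R a) (t - h) + c * h"
      using ball_min_growth[OF sub u lipschitz t \<rho>(1) \<rho>_cont \<rho>(2,3) subgradient] m(2)[OF t] by simp
    then show "?p \<bullet> a + (snd (g (x, t)) - m' t) \<le> c"
      using slope_le[of c] max by (simp add: algebra_simps)
  qed
  then show "snd (g (x, t)) + H x t ?v ?p \<le> 0"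
    using m(3)[OF t] by (simp add: inner_commute)
qed

end

subsection \<open>Subgradients and descent\<close>

lemma subdiffI:
  assumes \<phi>: "C1_on UNIV \<phi> g" and N: "z \<in> interior N" and min: "\<And>y. y \<in> N \<Longrightarrow> f z - \<phi> z \<le> f y - \<phi> y"
  shows "g z \<in> subdiff UNIV f z"
proof -
  obtain e where "e > 0" "ball z e \<subseteq> N" using N by (auto simp: mem_interior)
  then have "\<exists>e>0. \<forall>y\<in>UNIV. dist y z < e \<longrightarrow> f z - \<phi> z \<le> f y - \<phi> y"
    using min by (intro exI[of _ e]) (auto simp: dist_commute subset_iff)
  then show ?thesis using \<phi> unfolding subdiff_def by blast
qed

lemma ball_min_le_of_norm_subdiff_ge:
  fixes f :: "'a::euclidean_space \<Rightarrow> real"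
  assumes f: "continuous_on UNIV f" and "0 < \<theta>" "0 < r"
    and bound: "\<And>y p. y \<in> cball x r \<Longrightarrow> p \<in> subdiff UNIV f y \<Longrightarrow> \<theta> \<le> norm p"
  shows "ball_min f r x \<le> f x - \<theta> * r"
proof (rule ccontr)
  assume contrary: "\<not> ball_min f r x \<le> f x - \<theta> * r"
  define e where "e = (ball_min f r x - f x + \<theta> * r) / (2 * \<theta>)"
  have e: "e > 0" "ball_min f r x - f x + \<theta> * r = 2 * (\<theta> * e)"
    using contrary \<open>0 < \<theta>\<close> by (auto simp: e_def)
  define \<phi> where "\<phi> y = - \<theta> * smooth_norm e (y - x)" for y
  define g where "g y = - \<theta> *\<^sub>R smooth_norm_grad e (y - x)" for y
  have \<phi>: "C1_on UNIV \<phi> g"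
    unfolding \<phi>_def[abs_def] g_def[abs_def] using e(1) by (intro C1_on_cmult C1_on_smooth_norm_shift) simp
  have "continuous_on (cball x r) (\<lambda>y. f y - \<phi> y)"
    using continuous_on_subset[OF f] continuous_on_subset[OF C1_on_imp_continuous_on[OF \<phi>]]
    by (intro continuous_on_diff) auto
  then obtain y where y: "y \<in> cball x r" and min: "\<And>z. z \<in> cball x r \<Longrightarrow> f y - \<phi> y \<le> f z - \<phi> z"
    using continuous_attains_inf[of "cball x r" "\<lambda>y. f y - \<phi> y"] \<open>0 < r\<close> by auto
  have "dist x y \<noteq> r"
  proof
    assume "dist x y = r"
    then have "\<theta> * r < \<theta> * smooth_norm e (y - x)"
      using norm_less_smooth_norm[of e "y - x"] e(1) \<open>0 < \<theta>\<close> by (simp add: dist_norm norm_minus_commute)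
    moreover have "smooth_norm e (x - x) = e" using e(1) by (simp add: smooth_norm_def)
    then have "f y + \<theta> * smooth_norm e (y - x) \<le> f x + \<theta> * e"
      using min[of x] \<open>0 < r\<close> by (simp add: \<phi>_def)
    moreover have "0 < \<theta> * e" using e(1) \<open>0 < \<theta>\<close> by simp
    ultimately show False using ball_min_le[OF f y] e(2) by linarith
  qed
  then have "y \<in> interior (cball x r)" using y by simp
  from bound[OF y subdiffI[OF \<phi> this min]] have "\<theta> \<le> \<theta> * norm (smooth_norm_grad e (y - x))"
    using \<open>0 < \<theta>\<close> by (simp add: g_def)
  then show False using norm_smooth_norm_grad_less[of e "y - x"] e(1) \<open>0 < \<theta>\<close> by simp
qed

lemma subdiff_lower_expansion:
  fixes f :: "'a::euclidean_space \<Rightarrow> real"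
  assumes "p \<in> subdiff UNIV f x" "0 < c"
  obtains d where "0 < d" "\<And>y. dist y x < d \<Longrightarrow> f x - (norm p + c) * dist y x \<le> f y"
proof -
  obtain \<phi> g e where p: "p = g x" and \<phi>: "C1_on UNIV \<phi> g" and "0 < e"
    and min: "\<And>y. dist y x < e \<Longrightarrow> f x - \<phi> x \<le> f y - \<phi> y"
    using assms(1) by (auto simp: subdiff_def)
  have "(\<phi> has_derivative (\<lambda>h. p \<bullet> h)) (at x)" using \<phi> by (simp add: C1_on_def p)
  then obtain d where "0 < d" and expansion: "\<And>y. norm (y - x) < d \<Longrightarrow>
      norm (\<phi> y - \<phi> x - p \<bullet> (y - x)) \<le> c * norm (y - x)"
    using \<open>0 < c\<close> unfolding has_derivative_at_alt by blast
  have "f x - (norm p + c) * dist y x \<le> f y" if "dist y x < min d e" for y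
  proof -
    have "\<phi> x + p \<bullet> (y - x) - c * dist y x \<le> \<phi> y"
      using expansion[of y] that by (simp add: dist_norm abs_le_iff)
    moreover have "- (norm p * dist y x) \<le> p \<bullet> (y - x)"
      using Cauchy_Schwarz_ineq2[of p "y - x"] by (simp add: dist_norm)
    ultimately show ?thesis using min[of y] that by (simp add: algebra_simps)
  qed
  then show thesis using \<open>0 < d\<close> \<open>0 < e\<close> by (intro that[of "min d e"]) auto
qed

lemma norm_subdiff_ge_of_ball_min_le:
  fixes f :: "'a::euclidean_space \<Rightarrow> real"
  assumes f: "continuous_on UNIV f" and p: "p \<in> subdiff UNIV f x"
    and descent: "\<forall>\<^sub>F r in at_right 0. ball_min f r x \<le> f x - \<theta> * r"
  shows "\<theta> \<le> norm p"
proof (rule field_le_epsilon)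
  fix c :: real assume "0 < c"
  obtain d where "0 < d" and expansion: "\<And>y. dist y x < d \<Longrightarrow> f x - (norm p + c) * dist y x \<le> f y"
    using subdiff_lower_expansion[OF p \<open>0 < c\<close>] by blast
  have "\<forall>\<^sub>F r in at_right 0. 0 < r \<and> r < d \<and> ball_min f r x \<le> f x - \<theta> * r"
    using eventually_at_right_real[OF \<open>0 < d\<close>] descent by eventually_elim auto
  from eventually_happens'[OF trivial_limit_at_right_real this]
  obtain r where r: "0 < r" "r < d" "ball_min f r x \<le> f x - \<theta> * r" by blast
  obtain y where y: "y \<in> cball x r" "ball_min f r x = f y"
    using ball_min_attained[OF f less_imp_le[OF r(1)]] by metis
  have "\<theta> * r \<le> (norm p + c) * dist y x" using expansion[of y] y r by (simp add: dist_commute)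
  also have "\<dots> \<le> (norm p + c) * r" using y \<open>0 < c\<close> by (intro mult_left_mono) (auto simp: dist_commute)
  finally show "\<theta> \<le> norm p + c" using r(1) by simp
qed

lemma C1_on_slice:
  fixes \<phi> :: "'a::euclidean_space \<times> 'b::euclidean_space \<Rightarrow> real"
  assumes \<phi>: "C1_on (UNIV \<times> I) \<phi> g" and "t \<in> I"
  shows "C1_on UNIV (\<lambda>y. \<phi> (y, t)) (\<lambda>y. fst (g (y, t)))"
  unfolding C1_on_def
proof (intro conjI ballI)
  fix y :: 'a
  have "((\<lambda>y. (y, t)) has_derivative (\<lambda>h. (h, 0))) (at y)" by (auto intro!: derivative_eq_intros)
  moreover have "(\<phi> has_derivative (\<lambda>h. g (y, t) \<bullet> h)) (at (y, t))" using assms by (auto simp: C1_on_def)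
  ultimately have "((\<lambda>y. \<phi> (y, t)) has_derivative (\<lambda>h. g (y, t) \<bullet> (h, 0))) (at y)"
    by (rule has_derivative_compose)
  then show "((\<lambda>y. \<phi> (y, t)) has_derivative (\<lambda>h. fst (g (y, t)) \<bullet> h)) (at y)" by (simp add: inner_prod_def)
next
  have "continuous_on UNIV (\<lambda>y. (y, t))" by (intro continuous_intros)
  then have "continuous_on UNIV (\<lambda>y. g (y, t))"
    using continuous_on_compose2[OF C1_on_imp_continuous_on_gradient[OF \<phi>]] \<open>t \<in> I\<close> by auto
  then show "continuous_on UNIV (\<lambda>y. fst (g (y, t)))" by (rule continuous_on_fst)
qed

lemma subdiff_x_imp_subdiff:
  assumes "p \<in> subdiff_x T u x t" "0 < t" "t < T"
  shows "p \<in> subdiff UNIV (\<lambda>y. u y t) x"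
proof -
  obtain \<tau> \<phi> g e where p: "(p, \<tau>) = g (x, t)" and \<phi>: "C1_on (UNIV \<times> {0<..<T}) \<phi> g" and "0 < e"
    and min: "\<And>y s. 0 < s \<Longrightarrow> s < T \<Longrightarrow> dist (y, s) (x, t) < e \<Longrightarrow> u x t - \<phi> (x, t) \<le> u y s - \<phi> (y, s)"
    using assms(1) by (auto simp: subdiff_x_def subdiff_def)
  have "fst (g (x, t)) \<in> subdiff UNIV (\<lambda>y. u y t) x"
  proof (rule subdiffI)
    show "C1_on UNIV (\<lambda>y. \<phi> (y, t)) (\<lambda>y. fst (g (y, t)))" using C1_on_slice[OF \<phi>] assms by simp
    show "x \<in> interior (ball x e)" using \<open>0 < e\<close> by simp
    show "u x t - \<phi> (x, t) \<le> u y t - \<phi> (y, t)" if "y \<in> ball x e" for y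
      using that assms by (intro min) (auto simp: dist_Pair_Pair dist_commute)
  qed
  then show ?thesis by (simp flip: p)
qed

subsection \<open>The lower gradient bound\<close>

text \<open>At \<open>k = 0\<close> the junk value \<open>c / 0 = 0\<close> gives \<open>decay 0 c \<theta> t = \<theta>\<close>, which is the second case of the theorem.\<close>

definition decay :: "real \<Rightarrow> real \<Rightarrow> real \<Rightarrow> real \<Rightarrow> real" where
  "decay k c \<theta> t = \<theta> * exp (- k * t) - c / k * (1 - exp (- k * t))"

lemma decay_at_0 [simp]: "decay k c \<theta> 0 = \<theta>"
  by (simp add: decay_def)

lemma DERIV_decay: "k \<noteq> 0 \<Longrightarrow> (decay k c \<theta> has_real_derivative - k * decay k c \<theta> t - c) (at t)"
  unfolding decay_def[abs_def] by (auto intro!: derivative_eq_intros simp: field_simps)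

lemma decay_antimono:
  assumes "0 < k" "0 \<le> c" "0 \<le> \<theta>" "s \<le> t"
  shows "decay k c \<theta> t \<le> decay k c \<theta> s"
proof -
  have "(\<theta> + c / k) * exp (- k * t) \<le> (\<theta> + c / k) * exp (- k * s)"
    using assms by (intro mult_left_mono) auto
  then show ?thesis by (simp add: decay_def algebra_simps)
qed

lemma decay_pos_beyond:
  assumes k: "0 < k" "0 \<le> c" "0 \<le> \<theta>" and "t < T" and pos: "0 < decay k c \<theta> t"
  obtains T' where "t < T'" "T' \<le> T" "\<And>s. s < T' \<Longrightarrow> 0 < decay k c \<theta> s"
proof -
  have "isCont (decay k c \<theta>) t" using DERIV_isCont[OF DERIV_decay] k(1) by simp
  then have "\<forall>\<^sub>F s in at t. 0 < decay k c \<theta> s" using order_tendstoD(1) pos unfolding isCont_def by blast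
  then obtain e where "0 < e" and near: "\<And>s. s \<noteq> t \<Longrightarrow> dist s t < e \<Longrightarrow> 0 < decay k c \<theta> s"
    unfolding eventually_at by auto
  have "0 < decay k c \<theta> s" if "s < min T (t + e)" for s
  proof (cases "s \<le> t")
    case True
    then show ?thesis using decay_antimono[OF k True] pos by linarith
  next
    case False
    then show ?thesis using near[of s] that by (auto simp: dist_real_def)
  qed
  then show thesis using \<open>t < T\<close> \<open>0 < e\<close> by (intro that[of "min T (t + e)"]) auto
qed

lemma tendsto_decay:
  assumes "k \<noteq> 0 \<or> c = 0"
  shows "((\<lambda>\<kappa>. decay (k + \<kappa>) c \<theta> t) \<longlongrightarrow> decay k c \<theta> t) (at_right 0)"
proof (cases "k = 0")
  case True
  have "((\<lambda>\<kappa>. \<theta> * exp (- (k + \<kappa>) * t)) \<longlongrightarrow> \<theta> * exp (- (k + 0) * t)) (at_right 0)" by (intro tendsto_intros)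
  then show ?thesis using assms True by (simp add: decay_def)
next
  case False
  have "((\<lambda>\<kappa>. decay (k + \<kappa>) c \<theta> t) \<longlongrightarrow> decay (k + 0) c \<theta> t) (at_right 0)"
    unfolding decay_def using False by (intro tendsto_intros) auto
  then show ?thesis by simp
qed

locale hamilton_jacobi_solution = convex_hamiltonian T H C \<beta> A B K
  for T :: real and H :: "'a::euclidean_space \<Rightarrow> real \<Rightarrow> real \<Rightarrow> 'a \<Rightarrow> real" and C \<beta> A B K +
  fixes u :: "'a \<Rightarrow> real \<Rightarrow> real" and L :: real
  assumes u_sub: "subsolution T H u" and u_super: "supersolution T H u"
    and u_continuous: "continuous_on (UNIV \<times> {0..<T}) (\<lambda>(x, t). u x t)"
    and initial_lipschitz: "L-lipschitz_on UNIV (\<lambda>x. u x 0)"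
begin

lemma hamilton_jacobi_solution_mono_time:
  assumes "T' \<le> T"
  shows "hamilton_jacobi_solution T' H C \<beta> A B K u L"
proof
  show "continuous_on (UNIV \<times> {0..T'} \<times> UNIV \<times> UNIV) (\<lambda>(x, t, v, p). H x t v p)"
    using assms by (intro continuous_on_subset[OF continuous_H]) auto
  show "continuous_on (UNIV \<times> {0..<T'}) (\<lambda>(x, t). u x t)"
    using assms by (intro continuous_on_subset[OF u_continuous]) auto
qed (use assms in \<open>auto intro: nonneg K_nonneg H_space H_momentum H_value H_convex initial_lipschitz
    subsolution_mono_time[OF u_sub] supersolution_mono_time[OF u_super]\<close>)

lemma u_continuous_slice: "0 \<le> t \<Longrightarrow> t < T \<Longrightarrow> continuous_on UNIV (\<lambda>x. u x t)"
  by (intro continuous_on_curried[OF u_continuous] continuous_intros) auto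

lemma initial_difference_le: "u x 0 - u y 0 \<le> (L + \<beta> + 1) * dist x y"
proof -
  have "u x 0 - u y 0 \<le> L * dist x y"
    using lipschitz_onD[OF initial_lipschitz, of x y] by (simp add: dist_real_def)
  also have "\<dots> \<le> (L + \<beta> + 1) * dist x y" using nonneg(2) by (intro mult_right_mono) auto
  finally show ?thesis .
qed

lemma spatially_lipschitz:
  obtains N where "\<And>t. 0 \<le> t \<Longrightarrow> t < T \<Longrightarrow> N-lipschitz_on UNIV (\<lambda>x. u x t)"
proof -
  define l where "l = K + 2 * C + 1"
  define N where "N = exp (l * T) * (L + \<beta> + 1)"
  have "0 \<le> L" using lipschitz_on_nonneg[OF initial_lipschitz] .
  have "N-lipschitz_on UNIV (\<lambda>x. u x t)" if t: "0 \<le> t" "t < T" for t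
  proof (rule lipschitz_onI)
    have le: "u x t - u y t \<le> N * dist x y" for x y
    proof -
      have "u x t - u y t \<le> exp (l * t) * ((L + \<beta> + 1) * dist x y)"
        unfolding l_def using nonneg(2) \<open>0 \<le> L\<close>
        by (intro cone_comparison[OF u_sub u_super u_continuous u_continuous t less_add_one]
            initial_difference_le) auto
      also have "\<dots> \<le> exp (l * T) * ((L + \<beta> + 1) * dist x y)"
        using t nonneg K_nonneg \<open>0 \<le> L\<close> by (intro mult_right_mono) (auto simp: l_def intro: mult_left_mono)
      finally show ?thesis by (simp add: N_def mult_ac)
    qed
    show "dist (u x t) (u y t) \<le> N * dist x y" for x y
      using le[of x y] le[of y x] by (simp add: dist_real_def abs_le_iff dist_commute)
    show "0 \<le> N" using nonneg(2) \<open>0 \<le> L\<close> by (simp add: N_def)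
  qed
  then show thesis by (rule that)
qed

text \<open>The slack \<open>\<kappa>\<close> makes the radius \<open>\<rho>\<close> grow strictly faster than at rate \<open>C\<close>.\<close>

lemma ball_min_descent:
  assumes "0 < \<kappa>" "0 < \<epsilon>" and t: "0 \<le> t" "t < T"
    and decay_nonneg: "\<And>s. 0 < s \<Longrightarrow> s < T \<Longrightarrow> 0 \<le> decay (C + K + \<kappa>) (C * \<beta>) \<theta> s"
    and cone: "(A * norm x + B) * exp_primitive A t < R"
    and initial: "\<And>y. y \<in> cball x R \<Longrightarrow> ball_min (\<lambda>z. u z 0) \<epsilon> y \<le> u y 0 - \<theta> * \<epsilon>"
  shows "ball_min (\<lambda>y. u y t) (\<epsilon> * exp ((C + \<kappa>) * t)) x
    \<le> u x t - decay (C + K + \<kappa>) (C * \<beta>) \<theta> t * (\<epsilon> * exp ((C + \<kappa>) * t))"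
proof -
  let ?d = "decay (C + K + \<kappa>) (C * \<beta>) \<theta>"
  define \<rho> where "\<rho> s = \<epsilon> * exp ((C + \<kappa>) * s)" for s
  define m where "m s = ?d s * \<rho> s" for s
  define M where "M y s = ball_min (\<lambda>z. u z s) (\<rho> s) y + m s" for y s
  have \<rho>: "0 < \<rho> s" "(\<rho> has_real_derivative (C + \<kappa>) * \<rho> s) (at s)" "C * \<rho> s < (C + \<kappa>) * \<rho> s" for s
    using \<open>0 < \<epsilon>\<close> \<open>0 < \<kappa>\<close> unfolding \<rho>_def[abs_def] by (auto intro!: derivative_eq_intros)
  have "C + K + \<kappa> \<noteq> 0" using nonneg(1) K_nonneg \<open>0 < \<kappa>\<close> by linarith
  then have m_deriv: "(m has_real_derivative - K * m s - C * \<beta> * \<rho> s) (at s)" for s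
    unfolding m_def[abs_def] by (auto intro!: derivative_eq_intros DERIV_decay \<rho>(2) simp: algebra_simps)
  have \<rho>_cont: "continuous_on S \<rho>" and m_cont: "continuous_on S m" for S
    using \<rho>(2) m_deriv by (meson DERIV_continuous continuous_at_imp_continuous_on)+
  have m: "C1_on UNIV m (\<lambda>s. - K * m s - C * \<beta> * \<rho> s)"
    by (intro C1_on_real m_deriv continuous_intros \<rho>_cont m_cont)
  obtain N where lipschitz: "\<And>s. 0 \<le> s \<Longrightarrow> s < T \<Longrightarrow> N-lipschitz_on UNIV (\<lambda>x. u x s)"
    using spatially_lipschitz by blast
  have M_sub: "subsolution T H M"
    unfolding M_def[abs_def]
    by (rule subsolution_ball_min[OF u_sub u_continuous lipschitz \<rho> m])
      (use decay_nonneg \<rho>(1) in \<open>auto simp: m_def less_imp_le\<close>)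
  have "continuous_on (UNIV \<times> {0..<T}) (\<lambda>z::'a \<times> real. m (snd z))"
    by (rule continuous_on_compose2[OF m_cont continuous_on_snd[OF continuous_on_id] subset_UNIV])
  then have M_continuous: "continuous_on (UNIV \<times> {0..<T}) (\<lambda>(x, t). M x t)"
    using continuous_on_ball_min[OF u_continuous \<rho>_cont \<rho>(1)]
    by (simp add: M_def case_prod_unfold continuous_on_add)
  have "M y 0 - u z 0 \<le> (L + \<beta> + 1) * dist y z" if "y \<in> cball x R" for y z
    using initial[OF that] initial_difference_le[of y z] by (simp add: M_def m_def \<rho>_def)
  then have "M x t - u x t \<le> exp ((K + 2 * C + 1) * t) * ((L + \<beta> + 1) * dist x x)"
    using lipschitz_on_nonneg[OF initial_lipschitz] nonneg(2) cone
    by (intro cone_comparison[OF M_sub u_super M_continuous u_continuous t, where R = R]) auto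
  then show ?thesis by (simp add: M_def m_def \<rho>_def)
qed

lemma decay_le_norm_subdiff_perturbed:
  assumes p: "p \<in> subdiff UNIV (\<lambda>y. u y t) x" and t: "0 < t" "t < T" and "0 < \<kappa>" "0 < \<theta>"
    and cone: "(A * norm x + B) * exp_primitive A t + dist x x0 < r"
    and initial: "\<And>y q. y \<in> ball x0 r \<Longrightarrow> q \<in> subdiff UNIV (\<lambda>z. u z 0) y \<Longrightarrow> \<theta> \<le> norm q"
  shows "decay (C + K + \<kappa>) (C * \<beta>) \<theta> t \<le> norm p"
proof (cases "0 < decay (C + K + \<kappa>) (C * \<beta>) \<theta> t")
  case True
  let ?d = "decay (C + K + \<kappa>) (C * \<beta>) \<theta>"
  have "0 < C + K + \<kappa>" "0 \<le> C * \<beta>" using nonneg K_nonneg \<open>0 < \<kappa>\<close> by auto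
  then obtain T' where T': "t < T'" "T' \<le> T" and d_pos: "\<And>s. s < T' \<Longrightarrow> 0 < ?d s"
    using decay_pos_beyond[OF _ _ less_imp_le[OF \<open>0 < \<theta>\<close>] t(2) True] by blast
  interpret restricted: hamilton_jacobi_solution T' H C \<beta> A B K u L
    using hamilton_jacobi_solution_mono_time[OF T'(2)] .
  define gap where "gap = (r - (A * norm x + B) * exp_primitive A t - dist x x0) / 2"
  have "0 < gap" and gap: "2 * gap = r - (A * norm x + B) * exp_primitive A t - dist x x0"
    using cone by (simp_all add: gap_def)
  define E where "E = exp ((C + \<kappa>) * t)"
  have "ball_min (\<lambda>y. u y t) \<rho> x \<le> u x t - ?d t * \<rho>" if \<rho>: "0 < \<rho>" "\<rho> < gap * E" for \<rho>
  proof -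
    have \<epsilon>: "0 < \<rho> / E" "\<rho> / E < gap" "\<rho> / E * E = \<rho>" using \<rho> by (auto simp: E_def divide_less_eq)
    have "ball_min (\<lambda>y. u y t) (\<rho> / E * E) x \<le> u x t - ?d t * (\<rho> / E * E)"
      unfolding E_def
    proof (rule restricted.ball_min_descent[OF \<open>0 < \<kappa>\<close> _ less_imp_le[OF t(1)] T'(1)])
      show "(A * norm x + B) * exp_primitive A t < (A * norm x + B) * exp_primitive A t + gap"
        using \<open>0 < gap\<close> by simp
      fix y assume y: "y \<in> cball x ((A * norm x + B) * exp_primitive A t + gap)"
      have "z \<in> ball x0 r" if "z \<in> cball y (\<rho> / E)" for z
        using y that \<epsilon>(2) gap dist_triangle[of x0 z x] dist_triangle[of x z y] dist_commute[of x x0]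
        unfolding mem_ball mem_cball by linarith
      then show "ball_min (\<lambda>z. u z 0) (\<rho> / exp ((C + \<kappa>) * t)) y \<le> u y 0 - \<theta> * (\<rho> / exp ((C + \<kappa>) * t))"
        using u_continuous_slice[of 0] t \<epsilon>(1) \<open>0 < \<theta>\<close> initial
        by (intro ball_min_le_of_norm_subdiff_ge) (auto simp: E_def)
    qed (use \<epsilon> d_pos in \<open>auto simp: E_def less_imp_le\<close>)
    then show ?thesis unfolding \<epsilon>(3) .
  qed
  then have "\<forall>\<^sub>F \<rho> in at_right 0. ball_min (\<lambda>y. u y t) \<rho> x \<le> u x t - ?d t * \<rho>"
    using \<open>0 < gap\<close> unfolding eventually_at_right_field by (intro exI[of _ "gap * E"]) (auto simp: E_def)
  then show ?thesis
    using norm_subdiff_ge_of_ball_min_le[OF u_continuous_slice p] t by simp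
next
  case False
  then show ?thesis using norm_ge_zero[of p] by linarith
qed

lemma decay_le_norm_subdiff:
  assumes "p \<in> subdiff UNIV (\<lambda>y. u y t) x" "0 < t" "t < T" "0 < \<theta>"
    and "(A * norm x + B) * exp_primitive A t + dist x x0 < r"
    and "\<And>y q. y \<in> ball x0 r \<Longrightarrow> q \<in> subdiff UNIV (\<lambda>z. u z 0) y \<Longrightarrow> \<theta> \<le> norm q"
  shows "decay (C + K) (C * \<beta>) \<theta> t \<le> norm p"
proof (rule tendsto_upperbound)
  have "C + K \<noteq> 0 \<or> C * \<beta> = 0" using nonneg(1) K_nonneg by (cases "C = 0") auto
  then show "((\<lambda>\<kappa>. decay (C + K + \<kappa>) (C * \<beta>) \<theta> t) \<longlongrightarrow> decay (C + K) (C * \<beta>) \<theta> t) (at_right 0)"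
    by (rule tendsto_decay)
  show "\<forall>\<^sub>F \<kappa> in at_right 0. decay (C + K + \<kappa>) (C * \<beta>) \<theta> t \<le> norm p"
    using decay_le_norm_subdiff_perturbed[OF assms(1-3) _ assms(4-6)]
    by (intro eventually_at_rightI[of 0 1]) auto
qed simp

end

lemma Rfun_eq: "0 \<le> A \<Longrightarrow> Rfun A B x t = (A * norm x + B) * exp_primitive A t"
  by (auto simp: Rfun_def exp_primitive_def field_simps)

theorem theorem1p5:
  fixes T :: real and H :: "real^'n \<Rightarrow> real \<Rightarrow> real \<Rightarrow> real^'n \<Rightarrow> real"
    and u0 :: "real^'n \<Rightarrow> real" and u :: "real^'n \<Rightarrow> real \<Rightarrow> real"
    and C1 \<beta> A2 B2 K3 r \<theta> :: real and x0 :: "real^'n"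
  assumes T: "T > 0"
    and Hcont: "continuous_on (UNIV \<times> {0..T} \<times> UNIV \<times> UNIV) (\<lambda>(x, t, v, p). H x t v p)"
    and u0_lip: "\<exists>L. L-lipschitz_on UNIV u0"
    and H1: "C1 \<ge> 0" "\<beta> \<in> {0, 1}"
      "\<And>x y t v p. t \<in> {0..T} \<Longrightarrow> \<bar>H x t v p - H y t v p\<bar> \<le> C1 * (\<beta> + norm p) * dist x y"
    and H2: "A2 \<ge> 0" "B2 \<ge> 0"
      "\<And>x t v p q. t \<in> {0..T} \<Longrightarrow> \<bar>H x t v p - H x t v q\<bar> \<le> (A2 * norm x + B2) * dist p q"
    and H3: "K3 \<ge> 0"
      "\<And>x t v w p. t \<in> {0..T} \<Longrightarrow> \<bar>H x t v p - H x t w p\<bar> \<le> K3 * \<bar>v - w\<bar>"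
    and H4: "\<And>x t v. t \<in> {0..T} \<Longrightarrow> convex_on UNIV (\<lambda>p. H x t v p)"
    and r: "r > 0"
    and U: "\<theta> > 0" "\<And>x p. x \<in> ball x0 r \<Longrightarrow> p \<in> subdiff UNIV u0 x \<Longrightarrow> norm p \<ge> \<theta>"
    and sol: "visc_solution T H u0 u"
  shows "((C1, K3) \<noteq> (0, 0) \<longrightarrow>
            (\<forall>(x, t) \<in> Eset T A2 B2 x0 r. \<forall>p \<in> subdiff_x T u x t.
               norm p \<ge> \<theta> * exp (- (C1 + K3) * t)
                        - C1 * \<beta> / (C1 + K3) * (1 - exp (- (C1 + K3) * t))))
       \<and> ((C1, K3) = (0, 0) \<longrightarrow>
            (\<forall>(x, t) \<in> Eset T A2 B2 x0 r. \<forall>p \<in> subdiff_x T u x t. norm p \<ge> \<theta>))"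
proof -
  have u: "continuous_on (UNIV \<times> {0..<T}) (\<lambda>(x, t). u x t)" and u_initial: "\<And>x. u x 0 = u0 x"
    using sol by (auto simp: visc_solution_def)
  obtain L where L: "L-lipschitz_on UNIV (\<lambda>x. u x 0)" using u0_lip by (auto simp: u_initial)
  have "0 \<le> \<beta>" using H1(2) by auto
  note viscosity = visc_solution_imp_subsolution[OF sol] visc_solution_imp_supersolution[OF sol]
  interpret hamilton_jacobi_solution T H C1 \<beta> A2 B2 K3 u L
    by unfold_locales (fact Hcont H1 \<open>0 \<le> \<beta>\<close> H2 H3 H4 viscosity u L)+
  have "decay (C1 + K3) (C1 * \<beta>) \<theta> t \<le> norm p"
    if xt: "(x, t) \<in> Eset T A2 B2 x0 r" and p: "p \<in> subdiff_x T u x t" for x t p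
  proof (rule decay_le_norm_subdiff)
    show "0 < t" "t < T" "(A2 * norm x + B2) * exp_primitive A2 t + dist x x0 < r"
      using xt H2(1) by (auto simp: Eset_def Rfun_eq)
    then show "p \<in> subdiff UNIV (\<lambda>y. u y t) x" using subdiff_x_imp_subdiff[OF p] by blast
  qed (use U in \<open>auto simp: u_initial\<close>)
  then show ?thesis by (auto simp: decay_def)
qed

end
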